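(* Let $a\ge 2$ be an integer. There exists a constant $C$, independent of $n$, such that for every integer $n\ge 2$, if $\rho_{n,a}$ is a random permutation in $S_n$ with the unbiased $a$-shuffle distribution $P_{n,a}$, then $$d_K\left(\frac{\mathrm{inv}(\rho_{n,a})-\frac{n(n-1)}{4}\,\frac{a-1}{a}}{\sqrt{n}\,(n-1)\sqrt{\frac{a^2-1}{36a^2}}},\; Z\right)\le \frac{C}{\sqrt{n}},$$ where $Z$ is a standard normal random variable.
   Context: For $\pi\in S_n$, $\mathrm{inv}(\pi)=\#\{(i,j): 1\le i<j\le n,\ \pi(i)>\pi(j)\}$ is the number of inversions. Riffle shuffle distribution: let $\mathbf{p}=(p_1,\dots,p_a)$ be a probability vector. Starting with a deck of $n$ cards labelled $1,\dots,n$ from top to bottom, cut it into $a$ consecutive piles of sizes $b_1,\dots,b_a$ ($b_i\ge 0$, $\sum b_i=n$; the first pile consists of the top $b_1$ cards, the second of the next $b_2$ cards, and so on), where $(b_1,\dots,b_a)$ is chosen with probability $\binom{n}{b_1,\dots,b_a}\prod_{i=1}^a p_i^{b_i}$. Then choose uniformly one of the $\binom{n}{b_1,\dots,b_a}$ ways of interleaving the piles, keeping the cards of each pile in their original relative order. Let $\rho(i)$ be the label of the card in position $i$ after the shuffle. The law of the permutation $\rho\in S_n$ is denoted $P_{n,a,\mathbf{p}}$; when $\mathbf{p}=(1/a,\dots,1/a)$ the shuffle is called unbiased and the law is denoted $P_{n,a}$. The Kolmogorov distance between two real random variables (i.e. between their laws) is $d_K(X,Y)=\sup_{z\in\mathbb{R}}|\mathbb{P}(X\le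 z)-\mathbb{P}(Y\le z)|$. *)

theory Defs
  imports "HOL-Probability.Probability" "HOL-Combinatorics.Permutations"
begin

text \<open>
  A permutation in \<open>S\<^sub>n\<close> is a function \<open>\<pi> :: nat \<Rightarrow> nat\<close> with \<open>\<pi> permutes {1..n}\<close>, hence
  equal to the identity outside \<open>{1..n}\<close>.
\<close>

definition inversions :: "nat \<Rightarrow> (nat \<Rightarrow> nat) \<Rightarrow> nat" where
  "inversions n \<pi> = card {(i, j). 1 \<le> i \<and> i < j \<and> j \<le> n \<and> \<pi> i > \<pi> j}"

text \<open>
  A cut into piles \<open>1, \<dots>, a\<close> is given by the function \<open>b\<close> of pile sizes, set to \<open>0\<close> outside
  \<open>{1..a}\<close> so that each cut is represented once.
\<close>

definition cuts :: "nat \<Rightarrow> nat \<Rightarrow> (nat \<Rightarrow> nat) set" where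
  "cuts n a = {b. (\<forall>i. i \<notin> {1..a} \<longrightarrow> b i = 0) \<and> (\<Sum>i=1..a. b i) = n}"

definition multinomial :: "nat \<Rightarrow> nat \<Rightarrow> (nat \<Rightarrow> nat) \<Rightarrow> real" where
  "multinomial n a b = fact n / (\<Prod>i=1..a. fact (b i))"

definition cut_prob :: "nat \<Rightarrow> nat \<Rightarrow> (nat \<Rightarrow> real) \<Rightarrow> (nat \<Rightarrow> nat) \<Rightarrow> real" where
  "cut_prob n a p b = (if b \<in> cuts n a then multinomial n a b * (\<Prod>i=1..a. p i ^ b i) else 0)"

text \<open>
  Meaningful only if \<open>p 1, \<dots>, p a\<close> is a probability vector; see \<open>pmf_cut_pmf\<close> below.
\<close>

definition cut_pmf :: "nat \<Rightarrow> nat \<Rightarrow> (nat \<Rightarrow> real) \<Rightarrow> (nat \<Rightarrow> nat) pmf" where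
  "cut_pmf n a p = embed_pmf (cut_prob n a p)"

text \<open>Pile \<open>j\<close> consists of the consecutive labels following those of piles \<open>1, \<dots>, j - 1\<close>.\<close>

definition pile :: "(nat \<Rightarrow> nat) \<Rightarrow> nat \<Rightarrow> nat set" where
  "pile b j = {(\<Sum>i=1..<j. b i) <.. (\<Sum>i=1..j. b i)}"

text \<open>
  The cards being distinct, an interleaving of the piles is identified with the resulting
  arrangement \<open>\<rho>\<close>, where \<open>\<rho> s\<close> is the label of the card in position \<open>s\<close>.
\<close>

definition interleavings :: "nat \<Rightarrow> nat \<Rightarrow> (nat \<Rightarrow> nat) \<Rightarrow> (nat \<Rightarrow> nat) set" where
  "interleavings n a b =
     {\<rho>. \<rho> permutes {1..n} \<and> (\<forall>j\<in>{1..a}. strict_mono_on {s. \<rho> s \<in> pile b j} \<rho>)}"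

definition riffle_pmf :: "nat \<Rightarrow> nat \<Rightarrow> (nat \<Rightarrow> real) \<Rightarrow> (nat \<Rightarrow> nat) pmf" where
  "riffle_pmf n a p = bind_pmf (cut_pmf n a p) (\<lambda>b. pmf_of_set (interleavings n a b))"

definition unbiased_riffle_pmf :: "nat \<Rightarrow> nat \<Rightarrow> (nat \<Rightarrow> nat) pmf" where
  "unbiased_riffle_pmf n a = riffle_pmf n a (\<lambda>_. 1 / real a)"

text \<open>The supremum is over a set bounded by \<open>1\<close> when both laws are probability measures.\<close>

definition kolmogorov_dist :: "real measure \<Rightarrow> real measure \<Rightarrow> real" where
  "kolmogorov_dist \<mu> \<nu> = (SUP z. \<bar>cdf \<mu> z - cdf \<nu> z\<bar>)"

lemma cuts_0: "cuts n 0 = (if n = 0 then {\<lambda>_. 0} else {})"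
  by (auto simp: cuts_def)

lemma cuts_Suc:
  "bij_betw (\<lambda>(k, b). b(Suc a := k)) (SIGMA k:{..n}. cuts (n - k) a) (cuts n (Suc a))"
proof -
  have sum_upd: "(\<Sum>i=1..a. (b(Suc a := k)) i) = (\<Sum>i=1..a. b i)" for b :: "nat \<Rightarrow> nat" and k
    by (rule sum.cong) auto
  show ?thesis
    by (rule bij_betw_byWitness[where f' = "\<lambda>b. (b (Suc a), b(Suc a := 0))"])
       (auto simp: cuts_def fun_eq_iff sum_upd)
qed

lemma finite_cuts: "finite (cuts n a)"
proof (induction a arbitrary: n)
  case 0
  then show ?case by (simp add: cuts_0)
next
  case (Suc a)
  then have "finite (SIGMA k:{..n}. cuts (n - k) a)" by auto
  then show ?case using bij_betw_finite[OF cuts_Suc] by blast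
qed

lemma sum_cut_prob: "(\<Sum>b\<in>cuts n a. cut_prob n a p b) = (\<Sum>i=1..a. p i) ^ n"
proof -
  have "(\<Sum>b\<in>cuts n a. (\<Prod>i=1..a. p i ^ b i / fact (b i))) = (\<Sum>i=1..a. p i) ^ n / fact n"
  proof (induction a arbitrary: n)
    case 0
    then show ?case by (simp add: cuts_0)
  next
    case (Suc a)
    let ?g = "\<lambda>a b. (\<Prod>i=1..a. p i ^ b i / fact (b i))"
    let ?s = "\<Sum>i=1..a. p i"
    have g: "?g (Suc a) (b(Suc a := k)) = p (Suc a) ^ k / fact k * ?g a b" for b k
    proof -
      have "?g a (b(Suc a := k)) = ?g a b"
        by (rule prod.cong) auto
      then show ?thesis by simp
    qed
    have "(\<Sum>b\<in>cuts n (Suc a). ?g (Suc a) b)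
        = (\<Sum>(k, b)\<in>(SIGMA k:{..n}. cuts (n - k) a). ?g (Suc a) (b(Suc a := k)))"
      using sum.reindex_bij_betw[OF cuts_Suc, where g = "?g (Suc a)"]
      by (simp only: case_prod_unfold)
    also have "\<dots> = (\<Sum>k\<le>n. \<Sum>b\<in>cuts (n - k) a. ?g (Suc a) (b(Suc a := k)))"
      by (rule sum.Sigma[symmetric]) (auto simp: finite_cuts)
    also have "\<dots> = (\<Sum>k\<le>n. p (Suc a) ^ k / fact k * (?s ^ (n - k) / fact (n - k)))"
      by (simp only: g sum_distrib_left[symmetric] Suc.IH)
    also have "\<dots> = (\<Sum>k\<le>n. of_nat (n choose k) * p (Suc a) ^ k * ?s ^ (n - k)) / fact n"
      unfolding sum_divide_distrib
      by (rule sum.cong) (auto simp: binomial_fact field_simps)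
    also have "\<dots> = (\<Sum>i=1..Suc a. p i) ^ n / fact n"
      by (simp add: binomial_ring[symmetric] add.commute)
    finally show ?case .
  qed
  then have "fact n * (\<Sum>b\<in>cuts n a. (\<Prod>i=1..a. p i ^ b i / fact (b i))) = (\<Sum>i=1..a. p i) ^ n"
    by simp
  moreover have "(\<Sum>b\<in>cuts n a. cut_prob n a p b)
      = fact n * (\<Sum>b\<in>cuts n a. (\<Prod>i=1..a. p i ^ b i / fact (b i)))"
    by (simp add: sum_distrib_left cut_prob_def multinomial_def prod_dividef)
  ultimately show ?thesis by simp
qed

lemma pmf_cut_pmf:
  assumes "\<And>i. i \<in> {1..a} \<Longrightarrow> p i \<ge> 0" and "(\<Sum>i=1..a. p i) = 1"
  shows "pmf (cut_pmf n a p) b = cut_prob n a p b"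
  unfolding cut_pmf_def
proof (rule pmf_embed_pmf)
  show nn: "0 \<le> cut_prob n a p b" for b
    using assms(1) by (auto simp: cut_prob_def multinomial_def intro!: divide_nonneg_nonneg mult_nonneg_nonneg prod_nonneg)
  have "(\<integral>\<^sup>+b. ennreal (cut_prob n a p b) \<partial>count_space UNIV)
      = (\<Sum>b\<in>cuts n a. ennreal (cut_prob n a p b))"
    by (rule nn_integral_count_space'[OF finite_cuts]) (auto simp: cut_prob_def)
  also have "\<dots> = ennreal (\<Sum>b\<in>cuts n a. cut_prob n a p b)"
    by (rule sum_ennreal) (rule nn)
  finally show "(\<integral>\<^sup>+b. ennreal (cut_prob n a p b) \<partial>count_space UNIV) = 1"
    by (simp only: sum_cut_prob assms(2) power_one ennreal_1)
qed

lemma finite_interleavings: "finite (interleavings n a b)"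
  by (rule finite_subset[OF _ finite_permutations[of "{1..n}"]]) (auto simp: interleavings_def)

lemma interleavings_nonempty: "interleavings n a b \<noteq> {}"
proof -
  have "id \<in> interleavings n a b"
    by (auto simp: interleavings_def permutes_id strict_mono_on_def)
  then show ?thesis by blast
qed

end

theory Submission
  imports Defs "HOL-Combinatorics.Multiset_Permutations"
begin

text \<open>
  Cutting and interleaving assigns to every position the pile that its card comes from. For the
  unbiased shuffle this word \<open>x\<close> of pile numbers is uniformly distributed over all words of length
  \<open>n\<close> in the letters \<open>1, \<dots>, a\<close>, and two positions form an inversion of the shuffled deck exactly if
  their letters do: cards of one pile keep their order, and later piles carry larger labels. So the
  theorem concerns the inversions of a uniform random word (\<open>inversions_riffle_pmf\<close>).

  The number of inversions \<open>S\<close> of the word is a sum over pairs of independent letters. Its Hoeffding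
  decomposition \<open>S - \<mu> = L + Q\<close> (\<open>hoeffding_decomposition\<close>) has a linear part \<open>L\<close> of order
  \<open>n powr (3/2)\<close> and a completely degenerate part \<open>Q\<close> of order only \<open>n\<close>. Let \<open>S'\<close> come from \<open>S\<close> by
  resampling one letter at a uniformly chosen position. Then \<open>(S, S')\<close> is an exchangeable pair,
  \<open>\<bar>S - S'\<bar> \<le> n - 1\<close>, and since resampling destroys a term of \<open>L\<close> in one of \<open>n\<close> cases and a term of
  \<open>Q\<close> in two of \<open>n\<close>, the conditional expectation of \<open>S - S'\<close> given the word is \<open>(L + 2 * Q) / n\<close>
  (\<open>inversions_drift\<close>).

  Stein's method for exchangeable pairs, in the form that Shao and Zhang gave to it, turns this into
  a bound on the Kolmogorov distance (\<open>exchangeable_pair_normal_bound\<close>). For the normalised pair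
  \<open>(W, W')\<close> with \<open>\<bar>W - W'\<bar> \<le> A\<close> and drift \<open>\<lambda> * (W + R)\<close>, three quantities have to be of
  order \<open>1 / sqrt n\<close>: the mean of \<open>\<bar>R\<bar>\<close>, where \<open>R\<close> is the normalised \<open>Q\<close>; \<open>A\<close> times the mean of
  \<open>\<bar>W + R\<bar>\<close>; and the mean deviation from \<open>1\<close> of the conditional second moment of \<open>W - W'\<close>, divided by
  \<open>2 * \<lambda>\<close>. The derivative of the Stein solution jumps, but it is a difference of two monotone bounded
  functions, and the means of their increments along the pair are controlled by the drift alone.

  All three are second moment computations, in which sums of pairwise orthogonal functions of the
  word occur (\<open>orthogonal_sum_first_moment\<close>); orthogonality always holds because averaging over
  a single letter already gives zero.
\<close>

section \<open>The Mills ratio of the normal distribution\<close>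

abbreviation (input) std_normal_cdf :: "real \<Rightarrow> real" ("\<Phi>") where
  "\<Phi> \<equiv> cdf std_normal_distribution"

abbreviation (input) phi :: "real \<Rightarrow> real" ("\<phi>") where
  "\<phi> \<equiv> std_normal_density"

lemma phi_pos: "\<phi> w > 0"
  by (simp add: normal_density_pos)

lemma phi_deriv: "(\<phi> has_real_derivative - w * \<phi> w) (at w)"
  unfolding std_normal_density_def[abs_def]
  by (auto intro!: derivative_eq_intros simp: field_simps)

lemma continuous_phi: "continuous_on A \<phi>"
  by (intro DERIV_continuous_on) (auto intro: DERIV_subset phi_deriv)

lemma phi_minus: "\<phi> (- w) = \<phi> w"
  by (simp add: std_normal_density_def)

lemma Phi_diff:
  assumes "a \<le> b"
  shows "\<Phi> b = \<Phi> a + integral {a..b} \<phi>"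
proof (cases "a = b")
  case False
  interpret real_distribution std_normal_distribution by (rule real_dist_normal_dist)
  have "\<Phi> b - \<Phi> a = measure std_normal_distribution {a<..b}"
    using False assms by (intro cdf_diff_eq) auto
  also have "\<dots> = measure std_normal_distribution {a..b}"
  proof -
    have "emeasure std_normal_distribution {a<..b} = emeasure std_normal_distribution {a..b}"
    proof (rule emeasure_eq_AE)
      show "AE x in std_normal_distribution. (x \<in> {a<..b}) = (x \<in> {a..b})"
        by (subst AE_density, simp, rule AE_mp[OF AE_lborel_singleton[of a]]) auto
    qed auto
    then show ?thesis by (simp add: measure_def)
  qed
  also have "\<dots> = integral {a..b} \<phi>"
  proof -
    have "(\<phi> has_integral integral {a..b} \<phi>) {a..b}"
      by (intro integrable_integral integrable_continuous_real continuous_phi)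
    then have "((\<lambda>x. if x \<in> {a..b} then \<phi> x else 0) has_integral integral {a..b} \<phi>) UNIV"
      by (simp only: has_integral_restrict_UNIV)
    then have "(\<integral>\<^sup>+ x. ennreal (if x \<in> {a..b} then \<phi> x else 0) \<partial>lborel)
        = ennreal (integral {a..b} \<phi>)"
      by (intro nn_integral_has_integral_lborel) auto
    also have "(\<integral>\<^sup>+ x. ennreal (if x \<in> {a..b} then \<phi> x else 0) \<partial>lborel)
        = (\<integral>\<^sup>+ x. ennreal (\<phi> x) * indicator {a..b} x \<partial>lborel)"
      by (intro nn_integral_cong) (auto split: split_indicator)
    finally have "(\<integral>\<^sup>+ x. ennreal (\<phi> x) * indicator {a..b} x \<partial>lborel)
        = ennreal (integral {a..b} \<phi>)" .
    then show ?thesis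
      by (simp add: measure_def emeasure_density integral_nonneg
           integrable_continuous_real continuous_phi)
  qed
  finally show ?thesis by simp
qed simp

lemma Phi_deriv: "(\<Phi> has_real_derivative \<phi> w) (at w)"
proof -
  have "((\<lambda>x. integral {w - 1..x} \<phi>) has_real_derivative \<phi> w) (at w within {w - 1..w + 1})"
    by (intro integral_has_real_derivative continuous_phi) auto
  then have "((\<lambda>x. \<Phi> (w - 1) + integral {w - 1..x} \<phi>) has_real_derivative \<phi> w)
      (at w within {w - 1..w + 1})"
    by (auto intro!: derivative_eq_intros)
  then have "(\<Phi> has_real_derivative \<phi> w) (at w within {w - 1..w + 1})"
    by (rule has_field_derivative_transform_within[where d = 1]) (auto simp: Phi_diff)
  moreover have "at w within {w - 1..w + 1} = at w"
    by (rule at_within_interior) auto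
  ultimately show ?thesis by simp
qed

lemma Phi_bounds: "0 \<le> \<Phi> w" "\<Phi> w \<le> 1"
proof -
  interpret real_distribution std_normal_distribution by (rule real_dist_normal_dist)
  show "0 \<le> \<Phi> w" "\<Phi> w \<le> 1" by (auto simp: cdf_nonneg cdf_bounded_prob)
qed

lemma Phi_lim: "(\<Phi> \<longlongrightarrow> 1) at_top" "(\<Phi> \<longlongrightarrow> 0) at_bot"
proof -
  interpret real_distribution std_normal_distribution by (rule real_dist_normal_dist)
  show "(\<Phi> \<longlongrightarrow> 1) at_top" "(\<Phi> \<longlongrightarrow> 0) at_bot"
    by (rule cdf_lim_at_top_prob, rule cdf_lim_at_bot)
qed

lemma Phi_minus: "\<Phi> (- w) = 1 - \<Phi> w"
proof -
  have "((\<lambda>w. \<Phi> w + \<Phi> (- w)) has_real_derivative 0) (at w)" for w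
  proof -
    have "((\<lambda>w. \<Phi> (- w)) has_real_derivative \<phi> (- w) * (- 1)) (at w)"
      by (rule DERIV_chain2[OF Phi_deriv]) (auto intro!: derivative_eq_intros)
    from DERIV_add[OF Phi_deriv this] show ?thesis by (simp add: phi_minus)
  qed
  then have const: "\<Phi> x + \<Phi> (- x) = \<Phi> w + \<Phi> (- w)" for x
    using DERIV_isconst_all[of "\<lambda>w. \<Phi> w + \<Phi> (- w)"] by blast
  have "((\<lambda>x. \<Phi> x + \<Phi> (- x)) \<longlongrightarrow> 1 + 0) at_top"
    by (intro tendsto_add Phi_lim filterlim_compose[OF Phi_lim(2)] filterlim_uminus_at_bot_at_top)
  then have "\<Phi> w + \<Phi> (- w) = 1"
    by (subst (asm) const) (simp add: tendsto_const_iff)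
  then show ?thesis by simp
qed

lemma phi_over_id_lim: "((\<lambda>x. \<phi> x / x) \<longlongrightarrow> 0) at_top"
  unfolding std_normal_density_def by real_asymp

text \<open>
  Both sides of this and of the next inequality tend to \<open>0\<close> as \<open>w\<close> tends to infinity, so it suffices that their difference,
  after division by a positive function of \<open>w\<close>, is monotone.
\<close>

lemma mills_upper:
  assumes "w > 0"
  shows "w * (1 - \<Phi> w) \<le> \<phi> w"
proof -
  let ?d = "\<lambda>x. \<phi> x / x - (1 - \<Phi> x)"
  have "?d x \<le> ?d w" if "w \<le> x" for x
  proof (rule DERIV_nonpos_imp_nonincreasing[OF that])
    fix y assume "w \<le> y"
    then have "y > 0" using assms by simp
    then have "(?d has_real_derivative - \<phi> y / y\<^sup>2) (at y)"
      by (auto intro!: derivative_eq_intros Phi_deriv phi_deriv simp: field_simps power2_eq_square)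
    moreover have "- \<phi> y / y\<^sup>2 \<le> 0" by (simp add: phi_pos less_imp_le)
    ultimately show "\<exists>d. (?d has_real_derivative d) (at y) \<and> d \<le> 0" by blast
  qed
  then have "eventually (\<lambda>x. ?d x \<le> ?d w) at_top"
    by (auto simp: eventually_at_top_linorder)
  moreover have "(?d \<longlongrightarrow> 0 - (1 - 1)) at_top"
    by (intro tendsto_intros Phi_lim phi_over_id_lim)
  ultimately have "0 \<le> ?d w"
    using tendsto_upperbound[of ?d 0 at_top "?d w"] by simp
  then show ?thesis using assms by (simp add: field_simps)
qed

lemma mills_lower: "w * \<phi> w \<le> (1 + w\<^sup>2) * (1 - \<Phi> w)"
proof -
  let ?d = "\<lambda>x. 1 - \<Phi> x - x * \<phi> x / (1 + x\<^sup>2)"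
  have "?d x \<le> ?d w" if "w \<le> x" for x
  proof (rule DERIV_nonpos_imp_nonincreasing[OF that])
    fix y :: real
    have nz: "1 + y\<^sup>2 \<noteq> 0" by (metis add_pos_nonneg less_irrefl zero_le_power2 zero_less_one)
    then have "(?d has_real_derivative 0 - \<phi> y - ((1 * \<phi> y + (- y * \<phi> y) * y) * (1 + y\<^sup>2)
         - (y * \<phi> y) * (2 * y)) / ((1 + y\<^sup>2) * (1 + y\<^sup>2))) (at y)"
      by (intro DERIV_diff DERIV_divide DERIV_mult DERIV_const Phi_deriv phi_deriv DERIV_ident)
         (auto intro!: derivative_eq_intros)
    also have "0 - \<phi> y - ((1 * \<phi> y + (- y * \<phi> y) * y) * (1 + y\<^sup>2)
         - (y * \<phi> y) * (2 * y)) / ((1 + y\<^sup>2) * (1 + y\<^sup>2)) = - 2 * \<phi> y / (1 + y\<^sup>2)\<^sup>2"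
      using nz by (simp add: divide_simps) (simp add: algebra_simps power2_eq_square)
    finally have "(?d has_real_derivative - 2 * \<phi> y / (1 + y\<^sup>2)\<^sup>2) (at y)" .
    moreover have "- 2 * \<phi> y / (1 + y\<^sup>2)\<^sup>2 \<le> 0" by (simp add: phi_pos less_imp_le)
    ultimately show "\<exists>d. (?d has_real_derivative d) (at y) \<and> d \<le> 0" by blast
  qed
  then have "eventually (\<lambda>x. ?d x \<le> ?d w) at_top"
    by (auto simp: eventually_at_top_linorder)
  moreover have "((\<lambda>x. x * \<phi> x / (1 + x\<^sup>2)) \<longlongrightarrow> 0) at_top"
    unfolding std_normal_density_def by real_asymp
  then have "(?d \<longlongrightarrow> 1 - 1 - 0) at_top"
    by (intro tendsto_intros Phi_lim)
  ultimately have "0 \<le> ?d w"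
    using tendsto_upperbound[of ?d 0 at_top "?d w"] by simp
  then have "w * \<phi> w / (1 + w\<^sup>2) \<le> 1 - \<Phi> w" by simp
  moreover have "1 + w\<^sup>2 > 0" by (simp add: add_pos_nonneg)
  ultimately show ?thesis by (simp add: pos_divide_le_eq mult.commute)
qed

definition mills :: "real \<Rightarrow> real" where
  "mills w = (1 - \<Phi> w) / \<phi> w"

lemma mills_nonneg: "0 \<le> mills w"
  by (simp add: mills_def Phi_bounds phi_pos less_imp_le)

lemma mills_deriv: "(mills has_real_derivative w * mills w - 1) (at w)"
proof -
  have "(mills has_real_derivative ((0 - \<phi> w) * \<phi> w - (1 - \<Phi> w) * (- w * \<phi> w)) / (\<phi> w * \<phi> w)) (at w)"
    unfolding mills_def[abs_def]
    by (intro DERIV_diff DERIV_divide DERIV_const Phi_deriv phi_deriv) (use phi_pos[of w] in auto)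
  also have "((0 - \<phi> w) * \<phi> w - (1 - \<Phi> w) * (- w * \<phi> w)) / (\<phi> w * \<phi> w) = w * mills w - 1"
    using phi_pos[of w] by (simp add: mills_def field_simps)
  finally show ?thesis .
qed

text \<open>
  The derivative is \<open>(1 + w\<^sup>2) * mills w - w\<close>, so this is \<open>mills_lower\<close> in disguise.
\<close>

lemma mono_id_mills: "u \<le> w \<Longrightarrow> u * mills u \<le> w * mills w"
proof (erule DERIV_nonneg_imp_nondecreasing)
  fix x
  have "((\<lambda>w. w * mills w) has_real_derivative 1 * mills x + (x * mills x - 1) * x) (at x)"
    by (intro DERIV_mult DERIV_ident mills_deriv)
  moreover have "0 \<le> 1 * mills x + (x * mills x - 1) * x"
  proof -
    have "x \<le> (1 + x\<^sup>2) * mills x"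
      using mills_lower[of x] phi_pos[of x] by (simp add: mills_def pos_le_divide_eq)
    then show ?thesis by (simp add: algebra_simps power2_eq_square)
  qed
  ultimately show "\<exists>y. ((\<lambda>w. w * mills w) has_real_derivative y) (at x) \<and> 0 \<le> y" by blast
qed

lemma id_mills_le_1: "w * mills w \<le> 1"
proof (cases "w > 0")
  case True
  then show ?thesis using mills_upper[OF True] phi_pos[of w] by (simp add: mills_def field_simps)
next
  case False
  then have "w * mills w \<le> 0" by (simp add: mult_nonpos_nonneg mills_nonneg)
  then show ?thesis by simp
qed

section \<open>Solution of the Stein equation for a half line\<close>

text \<open>
  The bounded solution \<open>f\<close> of \<open>f' w - w * f w = of_bool (w \<le> z) - \<Phi> z\<close>. By the symmetry of the
  normal distribution, \<open>mills (- w)\<close> is the quotient of \<open>\<Phi> w\<close> by the density.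
\<close>

definition stein_sol :: "real \<Rightarrow> real \<Rightarrow> real" where
  "stein_sol z w = (if w \<le> z then (1 - \<Phi> z) * mills (- w) else \<Phi> z * mills w)"

lemma stein_sol_right: "z \<le> w \<Longrightarrow> stein_sol z w = \<Phi> z * mills w"
  by (cases "z = w") (simp_all add: stein_sol_def mills_def Phi_minus phi_minus)

lemma stein_sol_left: "w \<le> z \<Longrightarrow> stein_sol z w = (1 - \<Phi> z) * mills (- w)"
  by (auto simp: stein_sol_def)

lemma mono_id_stein_sol:
  assumes "u \<le> w"
  shows "u * stein_sol z u \<le> w * stein_sol z w"
proof -
  have R: "u * stein_sol z u \<le> w * stein_sol z w" if "z \<le> u" "u \<le> w" for u w
    using mult_left_mono[OF mono_id_mills[OF that(2)] Phi_bounds(1)[of z]] that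
    by (simp add: stein_sol_right mult_ac)
  have L: "u * stein_sol z u \<le> w * stein_sol z w" if "w \<le> z" "u \<le> w" for u w
    using mult_left_mono[OF mono_id_mills[of "- w" "- u"], of "1 - \<Phi> z"] that
    by (simp add: stein_sol_left Phi_bounds mult_ac)
  consider "z \<le> u" | "w \<le> z" | "u \<le> z" "z \<le> w" by linarith
  then show ?thesis
    by cases (use R[of u w] L[of w u] assms in simp, use R[of u w] L[of w u] assms in simp,
      use R[of z w] L[of z u] in linarith)
qed

text \<open>
  By monotonicity only large arguments matter for the upper bound; at those, \<open>w * mills w\<close> is at
  most \<open>1\<close>. The lower bound is symmetric.
\<close>

lemma id_stein_sol_bound: "\<bar>w * stein_sol z w\<bar> \<le> 1"
proof -
  have 1: "x * y \<le> 1" if "0 \<le> x" "x \<le> 1" "y \<le> 1" for x y :: real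
    using that mult_left_mono[of y 1 x] by simp
  have "w * stein_sol z w \<le> max w z * stein_sol z (max w z)"
    by (rule mono_id_stein_sol) simp
  also have "\<dots> = \<Phi> z * (max w z * mills (max w z))"
    by (simp add: stein_sol_right)
  also have "\<dots> \<le> 1" by (rule 1) (auto simp: Phi_bounds id_mills_le_1)
  finally have up: "w * stein_sol z w \<le> 1" .
  have "- (w * stein_sol z w) \<le> - (min w z * stein_sol z (min w z))"
    by (simp only: neg_le_iff_le) (rule mono_id_stein_sol, simp)
  also have "\<dots> = (1 - \<Phi> z) * (- min w z * mills (- min w z))"
    by (simp add: stein_sol_left)
  also have "\<dots> \<le> 1" by (rule 1[OF _ _ id_mills_le_1]) (auto simp: Phi_bounds)
  finally show ?thesis using up by simp
qed

lemma stein_sol_nonneg: "0 \<le> stein_sol z w"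
  by (simp add: stein_sol_def mills_nonneg Phi_bounds)

text \<open>
  Near \<open>0\<close> the density is bounded below; away from \<open>0\<close> the bound on \<open>w * stein_sol z w\<close> suffices.
\<close>

lemma stein_sol_bounded: "\<exists>c. \<forall>z w. stein_sol z w \<le> c"
proof -
  define c where "c = max 1 (1 / \<phi> 1)"
  have M: "mills w \<le> c" if "\<bar>w\<bar> \<le> 1" for w
  proof -
    have "\<phi> 1 \<le> \<phi> w"
    proof -
      have "w\<^sup>2 \<le> 1" using that by (simp add: abs_square_le_1)
      then show ?thesis by (simp add: std_normal_density_def divide_right_mono)
    qed
    then have "mills w \<le> 1 / \<phi> 1"
      unfolding mills_def by (intro frac_le) (auto simp: Phi_bounds phi_pos)
    then show ?thesis by (simp add: c_def)
  qed
  have "stein_sol z w \<le> c" for z w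
  proof (cases "\<bar>w\<bar> \<le> 1")
    case True
    have 1: "x * y \<le> c" if "0 \<le> x" "x \<le> 1" "0 \<le> y" "y \<le> c" for x y :: real
      using mult_mono[of x 1 y c] that by auto
    show ?thesis using True unfolding stein_sol_def
      by (auto intro!: 1 simp: Phi_bounds M mills_nonneg)
  next
    case False
    then have "stein_sol z w \<le> \<bar>w * stein_sol z w\<bar>"
      using mult_right_mono[of 1 "\<bar>w\<bar>" "stein_sol z w"]
      by (simp add: abs_mult stein_sol_nonneg)
    also have "\<dots> \<le> c" using id_stein_sol_bound[of w z] by (simp add: c_def)
    finally show ?thesis .
  qed
  then show ?thesis by blast
qed

text \<open>
  The derivative of \<open>stein_sol z\<close> as dictated by the Stein equation. At the kink \<open>z\<close> this is
  the derivative from the left.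
\<close>

definition stein_deriv :: "real \<Rightarrow> real \<Rightarrow> real" where
  "stein_deriv z w = w * stein_sol z w + of_bool (w \<le> z) - \<Phi> z"

text \<open>
  Up to a constant, the derivative is the increasing function \<open>w * stein_sol z w\<close> plus a decreasing
  indicator.
  Subtracting the indicator instead gives a monotone function whose increments dominate those of both
  pieces.
\<close>

definition stein_mono :: "real \<Rightarrow> real \<Rightarrow> real" where
  "stein_mono z w = w * stein_sol z w - of_bool (w \<le> z)"

lemma stein_deriv_bound: "\<bar>stein_deriv z w\<bar> \<le> 2"
  using id_stein_sol_bound[of w z] Phi_bounds[of z] by (auto simp: stein_deriv_def)

lemma stein_mono_bound: "\<bar>stein_mono z w\<bar> \<le> 2"
  using id_stein_sol_bound[of w z] by (auto simp: stein_mono_def)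

text \<open>
  On each side of \<open>z\<close> the mean value theorem yields the derivative at an intermediate point, and
  \<open>w * stein_sol z w\<close> is monotone. An interval that contains \<open>z\<close> is split there.
\<close>

lemma stein_sol_increment:
  assumes "u \<le> w"
  shows "(w - u) * (u * stein_sol z u + of_bool (w \<le> z) - \<Phi> z) \<le> stein_sol z w - stein_sol z u"
    and "stein_sol z w - stein_sol z u \<le> (w - u) * (w * stein_sol z w + of_bool (u \<le> z) - \<Phi> z)"
proof -
  let ?f = "stein_sol z" and ?g = "\<lambda>w. w * stein_sol z w"
  have R: "(w - u) * (?g u - \<Phi> z) \<le> ?f w - ?f u \<and> ?f w - ?f u \<le> (w - u) * (?g w - \<Phi> z)"
    if uw: "z \<le> u" "u \<le> w" for u w
  proof (cases "u = w")
    case False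
    have "((\<lambda>x. \<Phi> z * mills x) has_real_derivative \<Phi> z * (x * mills x - 1)) (at x)" for x
      by (rule DERIV_cmult[OF mills_deriv])
    from MVT2[of u w "\<lambda>x. \<Phi> z * mills x", OF _ this] uw False
    obtain x where x: "u < x" "x < w"
      "\<Phi> z * mills w - \<Phi> z * mills u = (w - u) * (\<Phi> z * (x * mills x - 1))" by auto
    then have "?f w - ?f u = (w - u) * (?g x - \<Phi> z)"
      using uw by (simp add: stein_sol_right algebra_simps)
    moreover have "?g u \<le> ?g x" "?g x \<le> ?g w" using x by (auto intro: mono_id_stein_sol)
    ultimately show ?thesis using uw by (auto intro!: mult_left_mono)
  qed simp
  have L: "(w - u) * (?g u + 1 - \<Phi> z) \<le> ?f w - ?f u \<and> ?f w - ?f u \<le> (w - u) * (?g w + 1 - \<Phi> z)"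
    if uw: "w \<le> z" "u \<le> w" for u w
  proof (cases "u = w")
    case False
    have "((\<lambda>x. (1 - \<Phi> z) * mills (- x)) has_real_derivative
        (1 - \<Phi> z) * ((- x * mills (- x) - 1) * (- 1))) (at x)" for x
      by (rule DERIV_cmult, rule DERIV_chain2[OF mills_deriv]) (auto intro!: derivative_eq_intros)
    from MVT2[of u w "\<lambda>x. (1 - \<Phi> z) * mills (- x)", OF _ this] uw False
    obtain x where x: "u < x" "x < w"
      "(1 - \<Phi> z) * mills (- w) - (1 - \<Phi> z) * mills (- u) =
         (w - u) * ((1 - \<Phi> z) * ((- x * mills (- x) - 1) * (- 1)))" by auto
    then have "?f w - ?f u = (w - u) * (?g x + 1 - \<Phi> z)"
      using uw by (simp add: stein_sol_left) (simp add: algebra_simps)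
    moreover have "?g u \<le> ?g x" "?g x \<le> ?g w" using x by (auto intro: mono_id_stein_sol)
    ultimately show ?thesis using uw by (auto intro!: mult_left_mono)
  qed simp
  consider "z < u" | "w \<le> z" | "u \<le> z" "z < w" by linarith
  then have "(w - u) * (?g u + of_bool (w \<le> z) - \<Phi> z) \<le> ?f w - ?f u \<and>
    ?f w - ?f u \<le> (w - u) * (?g w + of_bool (u \<le> z) - \<Phi> z)"
  proof cases
    case 3
    have "?g u \<le> ?g z" "?g z \<le> ?g w" using 3 by (auto intro: mono_id_stein_sol)
    then have "(w - z) * (?g u - \<Phi> z) \<le> (w - z) * (?g z - \<Phi> z)"
      "(z - u) * (?g u - \<Phi> z) \<le> (z - u) * (?g u + 1 - \<Phi> z)"
      "(w - z) * (?g w - \<Phi> z) \<le> (w - z) * (?g w + 1 - \<Phi> z)"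
      "(z - u) * (?g z + 1 - \<Phi> z) \<le> (z - u) * (?g w + 1 - \<Phi> z)"
      using 3 by (auto intro!: mult_left_mono)
    moreover have "(w - u) * x = (w - z) * x + (z - u) * x" for x by (simp add: algebra_simps)
    ultimately show ?thesis using R[of z w] L[of z u] 3 by (simp; linarith)
  qed (use R[of u w] L[of w u] assms in auto)
  then show "(w - u) * (?g u + of_bool (w \<le> z) - \<Phi> z) \<le> ?f w - ?f u"
    and "?f w - ?f u \<le> (w - u) * (?g w + of_bool (u \<le> z) - \<Phi> z)" by auto
qed

lemma mono_stein_mono: "u \<le> w \<Longrightarrow> stein_mono z u \<le> stein_mono z w"
  using mono_id_stein_sol[of u w z] by (auto simp: stein_mono_def)

text \<open>
  The error of the first order expansion of \<open>stein_sol z\<close> is bounded by an increment of a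
  monotone function, times \<open>w - u\<close> and not its absolute value. When \<open>w\<close> and \<open>u\<close> are the components
  of an exchangeable pair, the mean of such an expression can be computed from the drift.
\<close>

lemma stein_sol_taylor:
  assumes "\<bar>w - u\<bar> \<le> A"
  shows "\<bar>(w - u) * (stein_sol z w - stein_sol z u) - (w - u)\<^sup>2 * stein_deriv z w\<bar>
    \<le> A * ((w - u) * (stein_mono z w - stein_mono z u))"
proof -
  let ?f = "stein_sol z" and ?k = "stein_mono z"
  have key: "\<bar>(w - u) * (?f w - ?f u) - (w - u)\<^sup>2 * stein_deriv z v\<bar> \<le> (w - u)\<^sup>2 * (?k w - ?k u)"
    if uw: "u \<le> w" and v: "v = u \<or> v = w" for u v w
  proof -
    let ?l = "u * ?f u + of_bool (w \<le> z) - \<Phi> z" and ?r = "w * ?f w + of_bool (u \<le> z) - \<Phi> z"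
    have "(w - u) * ((w - u) * ?l) \<le> (w - u) * (?f w - ?f u)"
      "(w - u) * (?f w - ?f u) \<le> (w - u) * ((w - u) * ?r)"
      using uw by (intro mult_left_mono stein_sol_increment; simp)+
    then have increment: "(w - u)\<^sup>2 * ?l \<le> (w - u) * (?f w - ?f u)"
      "(w - u) * (?f w - ?f u) \<le> (w - u)\<^sup>2 * ?r"
      by (simp_all only: power2_eq_square mult.assoc)
    have "?r - stein_deriv z v \<le> ?k w - ?k u" "stein_deriv z v - ?l \<le> ?k w - ?k u"
      using v uw mono_id_stein_sol[OF uw, of z] by (auto simp: stein_deriv_def stein_mono_def)
    then have "(w - u)\<^sup>2 * (?r - stein_deriv z v) \<le> (w - u)\<^sup>2 * (?k w - ?k u)"
      "(w - u)\<^sup>2 * (stein_deriv z v - ?l) \<le> (w - u)\<^sup>2 * (?k w - ?k u)"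
      by (auto intro!: mult_left_mono)
    with increment show ?thesis
      unfolding right_diff_distrib[of "(w - u)\<^sup>2"] by linarith
  qed
  have "\<bar>(w - u) * (?f w - ?f u) - (w - u)\<^sup>2 * stein_deriv z w\<bar> \<le> \<bar>w - u\<bar> * \<bar>(w - u) * (?k w - ?k u)\<bar>"
  proof (cases "u \<le> w")
    case True
    then show ?thesis using key[OF True, of w] mono_stein_mono[OF True, of z]
      by (simp add: power2_eq_square abs_mult mult.assoc)
  next
    case False
    then have "(u - w) * (?f u - ?f w) = (w - u) * (?f w - ?f u)" by (simp add: algebra_simps)
    then show ?thesis using key[of w u w] mono_stein_mono[of w u z] False
      by (simp add: power2_commute[of w u]) (simp add: power2_eq_square abs_mult mult.assoc)
  qed
  also have "\<dots> \<le> A * \<bar>(w - u) * (?k w - ?k u)\<bar>"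
    using assms by (intro mult_right_mono) auto
  also have "\<bar>(w - u) * (?k w - ?k u)\<bar> = (w - u) * (?k w - ?k u)"
    using mono_stein_mono[of u w z] mono_stein_mono[of w u z]
    by (intro abs_of_nonneg; cases "u \<le> w") (auto intro: mult_nonneg_nonneg mult_nonpos_nonpos)
  finally show ?thesis .
qed

section \<open>Exchangeable pairs on a finite probability space\<close>

definition mean :: "'a set \<Rightarrow> ('a \<Rightarrow> real) \<Rightarrow> real" where
  "mean S f = (\<Sum>x\<in>S. f x) / real (card S)"

lemma mean_add: "mean S (\<lambda>x. f x + g x) = mean S f + mean S g"
  by (simp add: mean_def sum.distrib add_divide_distrib)

lemma mean_diff: "mean S (\<lambda>x. f x - g x) = mean S f - mean S g"
  by (simp add: mean_def sum_subtractf diff_divide_distrib)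

lemma mean_cmult: "mean S (\<lambda>x. c * f x) = c * mean S f"
  by (simp add: mean_def sum_distrib_left)

lemma mean_minus: "mean S (\<lambda>x. - f x) = - mean S f"
  by (simp add: mean_def sum_negf)

lemma mean_cmult_right: "mean S (\<lambda>x. f x * c) = mean S f * c"
  by (simp add: mean_def sum_distrib_right)

lemma mean_divide: "mean S (\<lambda>x. f x / c) = mean S f / c"
  using mean_cmult_right[of S f "inverse c"] by (simp add: field_simps)

lemma mean_const: "finite S \<Longrightarrow> S \<noteq> {} \<Longrightarrow> mean S (\<lambda>_. c) = c"
  by (simp add: mean_def)

lemma mean_cong: "(\<And>x. x \<in> S \<Longrightarrow> f x = g x) \<Longrightarrow> mean S f = mean S g"
  by (simp add: mean_def)

lemma mean_mono: "(\<And>x. x \<in> S \<Longrightarrow> f x \<le> g x) \<Longrightarrow> mean S f \<le> mean S g"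
  by (simp add: mean_def divide_right_mono sum_mono)

lemma mean_abs_le: "\<bar>mean S f\<bar> \<le> mean S (\<lambda>x. \<bar>f x\<bar>)"
  by (simp add: mean_def divide_right_mono)

lemma mean_sum: "mean S (\<lambda>x. \<Sum>k\<in>K. f x k) = (\<Sum>k\<in>K. mean S (\<lambda>x. f x k))"
  unfolding mean_def sum_divide_distrib[symmetric] by (subst sum.swap) simp

lemma mean_swap: "mean S (\<lambda>x. mean T (f x)) = mean T (\<lambda>y. mean S (\<lambda>x. f x y))"
  unfolding mean_def sum_divide_distrib[symmetric] by (subst sum.swap) (simp add: mult.commute)

lemma mean_Times: "mean (A \<times> B) f = mean A (\<lambda>i. mean B (\<lambda>c. f (i, c)))"
  by (simp add: mean_def card_cartesian_product sum_divide_distrib[symmetric] sum.cartesian_product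
      case_prod_unfold mult.commute)

lemma mean_nonneg: "(\<And>x. x \<in> S \<Longrightarrow> 0 \<le> f x) \<Longrightarrow> 0 \<le> mean S f"
  by (simp add: mean_def sum_nonneg)

lemma mean_le_const: "finite S \<Longrightarrow> S \<noteq> {} \<Longrightarrow> (\<And>x. x \<in> S \<Longrightarrow> f x \<le> c) \<Longrightarrow> mean S f \<le> c"
  using mean_mono[of S f "\<lambda>_. c"] by (simp add: mean_const)

text \<open>
  The pair consists of a uniform point \<open>x\<close> of \<open>S\<close> and the point \<open>Y x k\<close> reached by a uniform random
  move \<open>k\<close>. Write \<open>D\<close> for the difference of the values of \<open>W\<close>. For every function \<open>F\<close>,
  exchangeability gives that the mean of \<open>D * (F x - F (Y x k))\<close> is \<open>2 * lam\<close> times the mean of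
  \<open>(W + R) * F\<close>. This is used twice. For the Stein solution it rewrites the mean of \<open>W * f\<close>, so that
  after an expansion of \<open>f\<close> the Stein equation leaves the deviation of the conditional mean of \<open>D\<^sup>2\<close> from
  \<open>2 * lam\<close>, a term with \<open>R\<close>, and the error of the expansion. For \<open>stein_mono z\<close>, which is bounded by
  \<open>2\<close>, it bounds that error.
\<close>

lemma exchangeable_pair_normal_bound:
  fixes W R :: "'a \<Rightarrow> real" and Y :: "'a \<Rightarrow> 'k \<Rightarrow> 'a"
  assumes S: "finite S" "S \<noteq> {}" and K: "finite K" "K \<noteq> {}"
    and exch: "\<And>F. mean S (\<lambda>x. mean K (\<lambda>k. F x (Y x k))) = mean S (\<lambda>x. mean K (\<lambda>k. F (Y x k) x))"
    and drift: "\<And>x. x \<in> S \<Longrightarrow> mean K (\<lambda>k. W x - W (Y x k)) = lam * (W x + R x)"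
    and jump: "\<And>x k. x \<in> S \<Longrightarrow> k \<in> K \<Longrightarrow> \<bar>W x - W (Y x k)\<bar> \<le> A"
    and lam: "lam > 0"
    and c: "\<And>w. stein_sol z w \<le> c"
  shows "\<bar>mean S (\<lambda>x. of_bool (W x \<le> z)) - \<Phi> z\<bar>
    \<le> 2 * mean S (\<lambda>x. \<bar>1 - mean K (\<lambda>k. (W x - W (Y x k))\<^sup>2) / (2 * lam)\<bar>)
      + c * mean S (\<lambda>x. \<bar>R x\<bar>) + 2 * A * mean S (\<lambda>x. \<bar>W x + R x\<bar>)"
proof -
  define f where "f = (\<lambda>x. stein_sol z (W x))"
  define d where "d = (\<lambda>x. stein_deriv z (W x))"
  define m where "m = (\<lambda>x. stein_mono z (W x))"
  let ?D = "\<lambda>x k. W x - W (Y x k)"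
  define V where "V = (\<lambda>x. mean K (\<lambda>k. (?D x k)\<^sup>2))"
  define E where "E = (\<lambda>x. mean K (\<lambda>k. ?D x k * (f x - f (Y x k)) - (?D x k)\<^sup>2 * d x))"
  have antisym: "mean S (\<lambda>x. mean K (\<lambda>k. ?D x k * (F x - F (Y x k))))
      = 2 * lam * mean S (\<lambda>x. (W x + R x) * F x)" for F :: "'a \<Rightarrow> real"
  proof -
    have "mean S (\<lambda>x. mean K (\<lambda>k. ?D x k * F x))
        = mean S (\<lambda>x. mean K (\<lambda>k. - (?D x k * F (Y x k))))"
      using exch[of "\<lambda>x y. (W x - W y) * F x"] by (simp add: algebra_simps)
    also have "\<dots> = - mean S (\<lambda>x. mean K (\<lambda>k. ?D x k * F (Y x k)))"
      by (simp only: mean_minus)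
    finally have "mean S (\<lambda>x. mean K (\<lambda>k. ?D x k * (F x - F (Y x k))))
        = 2 * mean S (\<lambda>x. mean K (\<lambda>k. ?D x k * F x))"
      by (simp only: right_diff_distrib mean_diff)
    also have "mean S (\<lambda>x. mean K (\<lambda>k. ?D x k * F x)) = mean S (\<lambda>x. lam * ((W x + R x) * F x))"
      by (intro mean_cong) (simp only: mean_cmult_right drift mult.assoc)
    finally show ?thesis by (simp add: mean_cmult)
  qed
  have Ef: "mean S (\<lambda>x. mean K (\<lambda>k. ?D x k * (f x - f (Y x k))))
      = mean S (\<lambda>x. E x + V x * d x)"
    unfolding E_def V_def by (simp only: mean_diff mean_cmult_right) simp
  have "mean S (\<lambda>x. of_bool (W x \<le> z)) - \<Phi> z = mean S (\<lambda>x. of_bool (W x \<le> z) - \<Phi> z)"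
    using S by (simp add: mean_diff mean_const)
  also have "\<dots> = mean S (\<lambda>x. d x - W x * f x)"
    by (simp add: d_def f_def stein_deriv_def)
  also have "\<dots> = mean S (\<lambda>x. d x + R x * f x) - mean S (\<lambda>x. (W x + R x) * f x)"
    by (simp add: mean_diff[symmetric] algebra_simps)
  also have "mean S (\<lambda>x. (W x + R x) * f x) = mean S (\<lambda>x. (E x + V x * d x) / (2 * lam))"
    using antisym[of f] lam unfolding Ef mean_divide by (simp add: field_simps)
  also have "mean S (\<lambda>x. d x + R x * f x) - \<dots>
      = mean S (\<lambda>x. d x * (1 - V x / (2 * lam))) + mean S (\<lambda>x. R x * f x) - mean S E / (2 * lam)"
    by (simp only: mean_diff[symmetric] mean_add[symmetric] mean_divide[symmetric], rule mean_cong)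
       (use lam in \<open>simp add: field_simps\<close>)
  finally have eq: "mean S (\<lambda>x. of_bool (W x \<le> z)) - \<Phi> z =
    mean S (\<lambda>x. d x * (1 - V x / (2 * lam))) + mean S (\<lambda>x. R x * f x) - mean S E / (2 * lam)" .
  have 1: "\<bar>mean S (\<lambda>x. d x * (1 - V x / (2 * lam)))\<bar> \<le> 2 * mean S (\<lambda>x. \<bar>1 - V x / (2 * lam)\<bar>)"
    unfolding mean_cmult[symmetric]
    by (rule order_trans[OF mean_abs_le])
       (auto intro!: mean_mono mult_right_mono simp: abs_mult d_def stein_deriv_bound)
  have 2: "\<bar>mean S (\<lambda>x. R x * f x)\<bar> \<le> c * mean S (\<lambda>x. \<bar>R x\<bar>)"
    unfolding mean_cmult[symmetric]
    by (rule order_trans[OF mean_abs_le])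
       (auto intro!: mean_mono mult_right_mono c simp: abs_mult f_def stein_sol_nonneg mult.commute[of "\<bar>R _\<bar>"])
  have 3: "\<bar>mean S E\<bar> \<le> 2 * lam * (2 * A * mean S (\<lambda>x. \<bar>W x + R x\<bar>))"
  proof -
    obtain k where "k \<in> K" using K by auto
    moreover obtain x where "x \<in> S" using S by auto
    ultimately have A: "0 \<le> A" using jump[of x k] by simp
    have "\<bar>mean S E\<bar> \<le> mean S (\<lambda>x. mean K (\<lambda>k. \<bar>?D x k * (f x - f (Y x k)) - (?D x k)\<^sup>2 * d x\<bar>))"
      unfolding E_def by (intro order_trans[OF mean_abs_le] mean_mono mean_abs_le)
    also have "\<dots> \<le> mean S (\<lambda>x. mean K (\<lambda>k. A * (?D x k * (m x - m (Y x k)))))"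
      unfolding f_def d_def m_def by (intro mean_mono stein_sol_taylor jump)
    also have "\<dots> = A * (2 * lam * mean S (\<lambda>x. (W x + R x) * m x))"
      by (simp only: mean_cmult antisym)
    also have "\<dots> \<le> A * (2 * lam * mean S (\<lambda>x. \<bar>W x + R x\<bar> * 2))"
    proof (intro mult_left_mono mean_mono)
      fix x show "(W x + R x) * m x \<le> \<bar>W x + R x\<bar> * 2"
      proof -
        have "(W x + R x) * m x \<le> \<bar>W x + R x\<bar> * \<bar>m x\<bar>" by (simp add: abs_mult[symmetric])
        also have "\<dots> \<le> \<bar>W x + R x\<bar> * 2"
          by (intro mult_left_mono) (auto simp: m_def stein_mono_bound)
        finally show ?thesis .
      qed
    qed (use A lam in auto)
    finally show ?thesis unfolding mean_cmult_right by (simp only: mult_ac)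
  qed
  have "\<bar>mean S E / (2 * lam)\<bar> \<le> 2 * A * mean S (\<lambda>x. \<bar>W x + R x\<bar>)"
    using 3 lam by (simp add: abs_mult field_simps)
  then show ?thesis unfolding eq using 1 2 unfolding V_def by linarith
qed

lemma mean_abs_le_sqrt:
  assumes "finite S" "S \<noteq> {}"
  shows "mean S (\<lambda>x. \<bar>f x\<bar>) \<le> sqrt (mean S (\<lambda>x. (f x)\<^sup>2))"
proof -
  let ?m = "mean S (\<lambda>x. \<bar>f x\<bar>)"
  have "0 \<le> mean S (\<lambda>x. (\<bar>f x\<bar> - ?m)\<^sup>2)" by (rule mean_nonneg) simp
  also have "\<dots> = mean S (\<lambda>x. (f x)\<^sup>2 + ?m\<^sup>2 - (2 * ?m) * \<bar>f x\<bar>)"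
    by (simp add: power2_diff mult_ac)
  also have "\<dots> = mean S (\<lambda>x. (f x)\<^sup>2) - ?m\<^sup>2"
    using assms by (simp add: mean_add mean_diff mean_cmult mean_const power2_eq_square)
  finally show ?thesis by (intro real_le_rsqrt) simp
qed

section \<open>Sums of orthogonal functions\<close>

lemma orthogonal_sum_second_moment:
  assumes S: "finite S" "S \<noteq> {}" and K: "finite K"
    and orth: "\<And>k l. k \<in> K \<Longrightarrow> l \<in> K \<Longrightarrow> k \<noteq> l \<Longrightarrow> mean S (\<lambda>x. F k x * F l x) = 0"
    and bound: "\<And>k x. k \<in> K \<Longrightarrow> x \<in> S \<Longrightarrow> \<bar>F k x\<bar> \<le> M"
  shows "mean S (\<lambda>x. (\<Sum>k\<in>K. F k x)\<^sup>2) \<le> real (card K) * M\<^sup>2"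
proof -
  have "mean S (\<lambda>x. (\<Sum>k\<in>K. F k x)\<^sup>2) = (\<Sum>k\<in>K. \<Sum>l\<in>K. mean S (\<lambda>x. F k x * F l x))"
    by (simp add: power2_eq_square sum_product mean_sum)
  also have "\<dots> = (\<Sum>k\<in>K. mean S (\<lambda>x. F k x * F k x))"
  proof (rule sum.cong)
    fix k assume k: "k \<in> K"
    have "(\<Sum>l\<in>K. mean S (\<lambda>x. F k x * F l x)) = (\<Sum>l\<in>{k}. mean S (\<lambda>x. F k x * F l x))"
      using K k by (intro sum.mono_neutral_right) (use k orth[OF k] in auto)
    then show "(\<Sum>l\<in>K. mean S (\<lambda>x. F k x * F l x)) = mean S (\<lambda>x. F k x * F k x)" by simp
  qed simp
  also have "\<dots> \<le> (\<Sum>k\<in>K. M\<^sup>2)"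
  proof (intro sum_mono mean_le_const S)
    fix k x assume "k \<in> K" "x \<in> S"
    then have "\<bar>F k x\<bar>\<^sup>2 \<le> M\<^sup>2" by (intro power_mono bound) auto
    then show "F k x * F k x \<le> M\<^sup>2" by (simp add: power2_eq_square)
  qed
  finally show ?thesis by simp
qed

lemma orthogonal_sum_first_moment:
  assumes S: "finite S" "S \<noteq> {}" and K: "finite K"
    and orth: "\<And>k l. k \<in> K \<Longrightarrow> l \<in> K \<Longrightarrow> k \<noteq> l \<Longrightarrow> mean S (\<lambda>x. F k x * F l x) = 0"
    and bound: "\<And>k x. k \<in> K \<Longrightarrow> x \<in> S \<Longrightarrow> \<bar>F k x\<bar> \<le> M" and M: "0 \<le> M"
  shows "mean S (\<lambda>x. \<bar>\<Sum>k\<in>K. F k x\<bar>) \<le> sqrt (card K) * M"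
proof -
  have "mean S (\<lambda>x. \<bar>\<Sum>k\<in>K. F k x\<bar>) \<le> sqrt (mean S (\<lambda>x. (\<Sum>k\<in>K. F k x)\<^sup>2))"
    by (rule mean_abs_le_sqrt[OF S])
  also have "\<dots> \<le> sqrt (real (card K) * M\<^sup>2)"
    by (intro real_sqrt_le_mono orthogonal_sum_second_moment assms)
  also have "\<dots> = sqrt (card K) * M" using M by (simp add: real_sqrt_mult)
  finally show ?thesis .
qed

section \<open>Uniform random words\<close>

(* Otherwise simp turns the index sets {1..n} into {Suc 0..n}, and facts about them no longer match. *)
declare One_nat_def [simp del]

definition words :: "nat \<Rightarrow> nat \<Rightarrow> (nat \<Rightarrow> nat) set" where
  "words n a = {1..n} \<rightarrow>\<^sub>E {1..a}"

lemma finite_words: "finite (words n a)"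
  by (simp add: words_def finite_PiE)

lemma words_nonempty: "a > 0 \<Longrightarrow> words n a \<noteq> {}"
  by (simp add: words_def PiE_eq_empty_iff)

lemma word_letter: "x \<in> words n a \<Longrightarrow> i \<in> {1..n} \<Longrightarrow> x i \<in> {1..a}"
  by (auto simp: words_def PiE_def Pi_def)

lemma word_update: "x \<in> words n a \<Longrightarrow> i \<in> {1..n} \<Longrightarrow> c \<in> {1..a} \<Longrightarrow> x(i := c) \<in> words n a"
  by (auto simp: words_def PiE_def Pi_def extensional_def)

text \<open>
  Swapping the letter at position \<open>i\<close> with the fresh letter is an involution of the pairs
  consisting of a word and a fresh letter.
\<close>

lemma resample_exchangeable:
  assumes i: "i \<in> {1..n}"
  shows "mean (words n a) (\<lambda>x. mean {1..a} (\<lambda>c. F x (x(i := c))))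
       = mean (words n a) (\<lambda>x. mean {1..a} (\<lambda>c. F (x(i := c)) x))"
proof -
  have "(\<Sum>(x, c)\<in>words n a \<times> {1..a}. F x (x(i := c)))
      = (\<Sum>(x, c)\<in>words n a \<times> {1..a}. F (x(i := c)) x)"
    by (rule sum.reindex_bij_witness[where i = "\<lambda>(x, c). (x(i := c), x i)" and j = "\<lambda>(x, c). (x(i := c), x i)"])
       (use word_letter[OF _ i] word_update[OF _ i] in fastforce)+
  then show ?thesis
    by (simp add: mean_def sum_divide_distrib[symmetric] sum.cartesian_product)
qed

lemma mean_words_resample:
  assumes i: "i \<in> {1..n}" and a: "a > 0"
  shows "mean (words n a) F = mean (words n a) (\<lambda>x. mean {1..a} (\<lambda>c. F (x(i := c))))"
  using resample_exchangeable[OF i, where F = "\<lambda>x y. F x" and a = a] a by (simp add: mean_const)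

lemma mean_words_eq_0:
  assumes "i \<in> {1..n}" "a > 0"
    and "\<And>x. x \<in> words n a \<Longrightarrow> mean {1..a} (\<lambda>c. F (x(i := c))) = 0"
  shows "mean (words n a) F = 0"
  unfolding mean_words_resample[OF assms(1,2), of F]
  by (subst mean_cong[where g = "\<lambda>_. 0"]) (rule assms(3), simp, simp add: mean_def)

section \<open>The Hoeffding decomposition of the number of inversions\<close>

text \<open>
  Up to a sign that depends on the order of the positions, this is the conditional probability that a given letter \<open>c\<close> forms an inversion with a
  uniform random letter, minus the mean \<open>(a - 1) / (2 * a)\<close>: the first order part of the inversion
  indicator.
\<close>

definition centred :: "nat \<Rightarrow> nat \<Rightarrow> real" where
  "centred a c = (real c - (real a + 1) / 2) / real a"

text \<open>
  Whether the letters \<open>c\<close> at position \<open>i\<close> and \<open>d\<close> at position \<open>t\<close> form an inversion. Being symmetric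
  in the two positions and \<open>0\<close> on the diagonal, it can be summed over all \<open>t\<close> when the letter at \<open>i\<close>
  changes.
\<close>

definition beats :: "nat \<Rightarrow> nat \<Rightarrow> nat \<Rightarrow> nat \<Rightarrow> real" where
  "beats i t c d = (if i < t then of_bool (d < c) else if t < i then of_bool (c < d) else 0)"

text \<open>
  What remains of the inversion indicator after its mean and its first order parts in both letters
  are removed. It averages to \<open>0\<close> over each letter separately.
\<close>

definition residual :: "nat \<Rightarrow> nat \<Rightarrow> nat \<Rightarrow> nat \<Rightarrow> nat \<Rightarrow> real" where
  "residual a i t c d = (if i = t then 0 else
     beats i t c d - (real a - 1) / (2 * real a) - sgn (real t - real i) * (centred a c - centred a d))"

lemma beats_decomp: "beats i t c d = of_bool (i \<noteq> t) * ((real a - 1) / (2 * real a))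
    + sgn (real t - real i) * (centred a c - centred a d) + residual a i t c d"
  by (auto simp: residual_def beats_def)

lemma beats_sym: "beats i t c d = beats t i d c"
  by (auto simp: beats_def)

lemma residual_sym: "residual a i t c d = residual a t i d c"
  by (auto simp: residual_def beats_sym[of i t] sgn_if algebra_simps)

lemma residual_self [simp]: "residual a i i c d = 0"
  by (simp add: residual_def)

lemma sum_of_nat_1: "(\<Sum>i=1..n. real i) = real n * (real n + 1) / 2"
  by (induction n) (auto simp: field_simps)

lemma sum_of_nat_squares_1: "(\<Sum>i=1..n. (real i)\<^sup>2) = real n * (real n + 1) * (2 * real n + 1) / 6"
  by (induction n) (auto simp: field_simps power2_eq_square)

lemma mean_centred: "mean {1..a} (centred a) = 0"
  by (simp add: mean_def centred_def[abs_def] sum_divide_distrib[symmetric] sum_subtractf sum_of_nat_1)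

lemma mean_centred_sq:
  assumes "a > 0"
  shows "mean {1..a} (\<lambda>c. (centred a c)\<^sup>2) = ((real a)\<^sup>2 - 1) / (12 * (real a)\<^sup>2)"
proof -
  have "(\<Sum>c=1..a. (centred a c)\<^sup>2)
      = (\<Sum>c=1..a. (real c)\<^sup>2 - (real a + 1) * real c + (real a + 1)\<^sup>2 / 4) / (real a)\<^sup>2"
    by (simp add: centred_def power_divide sum_divide_distrib power2_eq_square algebra_simps)
  also have "(\<Sum>c=1..a. (real c)\<^sup>2 - (real a + 1) * real c + (real a + 1)\<^sup>2 / 4)
      = real a * ((real a)\<^sup>2 - 1) / 12"
    by (simp add: sum.distrib sum_subtractf sum_distrib_left[symmetric] sum_of_nat_1
        sum_of_nat_squares_1) (simp add: field_simps power2_eq_square)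
  finally show ?thesis using assms by (simp add: mean_def)
qed

lemma abs_centred_le: "c \<in> {1..a} \<Longrightarrow> \<bar>centred a c\<bar> \<le> 1 / 2"
  by (auto simp: centred_def abs_le_iff field_simps)

lemma mean_beats:
  assumes "d \<in> {1..a}" "i \<noteq> t"
  shows "mean {1..a} (\<lambda>c. beats i t c d) = (real a - 1) / (2 * real a) - sgn (real t - real i) * centred a d"
proof -
  have "{1..a} \<inter> {c. d < c} = {d<..a}" "{1..a} \<inter> {c. c < d} = {1..<d}" using assms by auto
  then have frac: "mean {1..a} (\<lambda>c. of_bool (d < c)) = (real a - real d) / real a"
    "mean {1..a} (\<lambda>c. of_bool (c < d)) = (real d - 1) / real a"
    using assms by (simp_all add: mean_def sum_of_bool_eq of_nat_diff)
  show ?thesis using assms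
    by (cases "i < t") (simp_all add: beats_def[abs_def] centred_def frac, simp_all add: field_simps)
qed

text \<open>
  Averaging over the other letter gives \<open>0\<close> as well, by \<open>residual_sym\<close>.
\<close>

lemma mean_residual:
  assumes "d \<in> {1..a}"
  shows "mean {1..a} (\<lambda>c. residual a i t c d) = 0"
proof (cases "i = t")
  case False
  have "a > 0" using assms by auto
  then show ?thesis using False mean_beats[OF assms False] mean_centred[of a]
    by (simp add: residual_def mean_diff mean_cmult mean_const)
qed (simp add: mean_def)

lemma abs_residual_le:
  assumes "c \<in> {1..a}" "d \<in> {1..a}"
  shows "\<bar>residual a i t c d\<bar> \<le> 2"
proof -
  have "0 \<le> (real a - 1) / (2 * real a)" "(real a - 1) / (2 * real a) \<le> 1"
    using assms by (auto simp: field_simps)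
  then show ?thesis
    using abs_centred_le[OF assms(1)] abs_centred_le[OF assms(2)]
    by (auto simp: residual_def beats_def sgn_if abs_le_iff)
qed

text \<open>
  The number of positions after \<open>i\<close> minus the number of positions before \<open>i\<close>: a large letter at
  position \<open>i\<close> tends to make inversions with the former and to avoid them with the latter.
\<close>

definition position_weight :: "nat \<Rightarrow> nat \<Rightarrow> real" where
  "position_weight n i = real n + 1 - 2 * real i"

definition ordered_pairs :: "nat \<Rightarrow> (nat \<times> nat) set" where
  "ordered_pairs n = {(i, t). 1 \<le> i \<and> i < t \<and> t \<le> n}"

definition linear_part :: "nat \<Rightarrow> nat \<Rightarrow> (nat \<Rightarrow> nat) \<Rightarrow> real" where
  "linear_part n a x = (\<Sum>i=1..n. position_weight n i * centred a (x i))"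

definition degenerate_part :: "nat \<Rightarrow> nat \<Rightarrow> (nat \<Rightarrow> nat) \<Rightarrow> real" where
  "degenerate_part n a x = (\<Sum>(i, t)\<in>ordered_pairs n. residual a i t (x i) (x t))"

lemma ordered_pairs_subset: "ordered_pairs n \<subseteq> {1..n} \<times> {1..n}"
  by (auto simp: ordered_pairs_def)

lemma finite_ordered_pairs: "finite (ordered_pairs n)"
  by (rule finite_subset[OF ordered_pairs_subset]) simp

lemma card_ordered_pairs_le: "card (ordered_pairs n) \<le> n\<^sup>2"
  using card_mono[OF _ ordered_pairs_subset, of n] by (simp add: power2_eq_square)

lemma sum_symmetric_pairs:
  fixes u :: "nat \<Rightarrow> nat \<Rightarrow> real"
  assumes "\<And>i t. u i t = u t i" "\<And>i. u i i = 0"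
  shows "(\<Sum>i=1..n. \<Sum>t=1..n. u i t) = 2 * (\<Sum>(i, t)\<in>ordered_pairs n. u i t)"
proof -
  let ?P = "ordered_pairs n" and ?Q = "{(i, t). (t, i) \<in> ordered_pairs n}" and ?D = "{(i, t). i = t \<and> i \<in> {1..n}}"
  have "?Q \<subseteq> {1..n} \<times> {1..n}" "?D \<subseteq> {1..n} \<times> {1..n}" by (auto simp: ordered_pairs_def)
  then have fin: "finite ?Q" "finite ?D" by (blast intro: finite_subset[OF _ finite_cartesian_product[OF finite_atLeastAtMost finite_atLeastAtMost]])+
  have "(\<Sum>i=1..n. \<Sum>t=1..n. u i t) = (\<Sum>(i, t)\<in>{1..n} \<times> {1..n}. u i t)"
    by (rule sum.cartesian_product)
  also have "{1..n} \<times> {1..n} = (?P \<union> ?Q) \<union> ?D"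
    by (auto simp: ordered_pairs_def)
  also have "(\<Sum>(i, t)\<in>\<dots>. u i t) = (\<Sum>(i, t)\<in>?P \<union> ?Q. u i t) + (\<Sum>(i, t)\<in>?D. u i t)"
    by (intro sum.union_disjoint finite_UnI finite_ordered_pairs fin) (auto simp: ordered_pairs_def)
  also have "(\<Sum>(i, t)\<in>?P \<union> ?Q. u i t) = (\<Sum>(i, t)\<in>?P. u i t) + (\<Sum>(i, t)\<in>?Q. u i t)"
    by (intro sum.union_disjoint finite_UnI finite_ordered_pairs fin) (auto simp: ordered_pairs_def)
  also have "(\<Sum>(i, t)\<in>?D. u i t) = 0" by (rule sum.neutral) (auto simp: assms)
  also have "(\<Sum>(i, t)\<in>?Q. u i t) = (\<Sum>(i, t)\<in>?P. u i t)"
    by (rule sum.reindex_bij_witness[where i = "\<lambda>(i, t). (t, i)" and j = "\<lambda>(i, t). (t, i)"])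
       (auto simp: assms(1))
  finally show ?thesis by simp
qed

lemma inversions_beats: "2 * real (inversions n x) = (\<Sum>i=1..n. \<Sum>t=1..n. beats i t (x i) (x t))"
proof -
  have "real (inversions n x) = real (card {p \<in> ordered_pairs n. x (snd p) < x (fst p)})"
    unfolding inversions_def ordered_pairs_def
    by (intro arg_cong[where f = "\<lambda>S. real (card S)"]) auto
  also have "\<dots> = (\<Sum>p\<in>ordered_pairs n. of_bool (x (snd p) < x (fst p)))"
    by (subst sum_of_bool_eq) (auto simp: finite_ordered_pairs intro!: arg_cong[where f = card])
  also have "\<dots> = (\<Sum>(i, t)\<in>ordered_pairs n. beats i t (x i) (x t))"
    by (rule sum.cong) (auto simp: beats_def ordered_pairs_def)
  finally show ?thesis
    by (subst sum_symmetric_pairs) (auto simp: beats_sym, simp add: beats_def)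
qed

lemma sum_sgn_position:
  assumes "i \<in> {1..n}"
  shows "(\<Sum>t=1..n. sgn (real t - real i)) = position_weight n i"
proof -
  have "{1..n} = {1..<i} \<union> {i} \<union> {i<..n}" using assms by auto
  then have "(\<Sum>t=1..n. sgn (real t - real i)) = (\<Sum>t\<in>{1..<i} \<union> {i} \<union> {i<..n}. sgn (real t - real i))"
    by simp
  also have "\<dots> = (\<Sum>t\<in>{1..<i}. sgn (real t - real i)) + (\<Sum>t\<in>{i<..n}. sgn (real t - real i))"
    by (subst sum.union_disjoint, auto)+
  also have "(\<Sum>t\<in>{1..<i}. sgn (real t - real i)) = (\<Sum>t\<in>{1..<i}. -1)"
    by (rule sum.cong) auto
  also have "(\<Sum>t\<in>{i<..n}. sgn (real t - real i)) = (\<Sum>t\<in>{i<..n}. 1)"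
    by (rule sum.cong) auto
  finally show ?thesis using assms by (simp add: position_weight_def of_nat_diff)
qed

lemma sum_residual:
  "(\<Sum>i=1..n. \<Sum>t=1..n. residual a i t (x i) (x t)) = 2 * degenerate_part n a x"
  unfolding degenerate_part_def by (rule sum_symmetric_pairs) (simp_all add: residual_sym)

lemma hoeffding_decomposition:
  "real (inversions n x) = real n * (real n - 1) / 4 * ((real a - 1) / real a)
     + linear_part n a x + degenerate_part n a x"
proof -
  let ?m = "(real a - 1) / (2 * real a)" and ?h = "\<lambda>i. centred a (x i)"
  have const: "(\<Sum>i=1..n. \<Sum>t=1..n. of_bool (i \<noteq> t) * ?m) = real n * (real n - 1) * ?m"
  proof -
    have "(\<Sum>t=1..n. of_bool (i \<noteq> t) * ?m) = (real n - 1) * ?m" if "i \<in> {1..n}" for i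
    proof -
      have "(\<Sum>t=1..n. of_bool (i \<noteq> t) * ?m) = (\<Sum>t\<in>{1..n} - {i}. ?m)"
        by (rule sum.mono_neutral_cong_right) auto
      then show ?thesis using that by (simp add: of_nat_diff)
    qed
    then have "(\<Sum>i=1..n. \<Sum>t=1..n. of_bool (i \<noteq> t) * ?m) = (\<Sum>i=1..n. (real n - 1) * ?m)"
      by (intro sum.cong) auto
    then show ?thesis by simp
  qed
  have "(\<Sum>i=1..n. \<Sum>t=1..n. sgn (real t - real i) * ?h i) = linear_part n a x"
    unfolding linear_part_def sum_distrib_right[symmetric]
    by (intro sum.cong) (auto simp: sum_sgn_position)
  moreover have "(\<Sum>i=1..n. \<Sum>t=1..n. sgn (real t - real i) * ?h t) = - linear_part n a x"
  proof -
    have neg: "(\<Sum>i=1..n. sgn (real t - real i)) = - position_weight n t" if "t \<in> {1..n}" for t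
      unfolding sum_sgn_position[OF that, symmetric] sum_negf[symmetric]
      by (rule sum.cong) (auto simp: sgn_if)
    have "(\<Sum>i=1..n. \<Sum>t=1..n. sgn (real t - real i) * ?h t)
        = (\<Sum>t=1..n. (\<Sum>i=1..n. sgn (real t - real i)) * ?h t)"
      by (subst sum.swap) (simp add: sum_distrib_right)
    also have "\<dots> = - linear_part n a x"
      unfolding linear_part_def sum_negf[symmetric]
      by (intro sum.cong) (simp_all add: neg)
    finally show ?thesis .
  qed
  ultimately have lin: "(\<Sum>i=1..n. \<Sum>t=1..n. sgn (real t - real i) * (?h i - ?h t)) = 2 * linear_part n a x"
    by (simp add: right_diff_distrib sum_subtractf)
  have "2 * real (inversions n x) = real n * (real n - 1) * ?m + 2 * linear_part n a x + 2 * degenerate_part n a x"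
    unfolding inversions_beats beats_decomp[where a = a] sum.distrib const lin sum_residual ..
  then show ?thesis by (simp add: field_simps)
qed

section \<open>Resampling one letter\<close>

text \<open>
  The contribution of position \<open>i\<close> to the degenerate part if it carried the letter \<open>c\<close>. It does not
  depend on the letter that \<open>x\<close> has at \<open>i\<close>, as the diagonal terms vanish.
\<close>

definition local_residual :: "nat \<Rightarrow> nat \<Rightarrow> (nat \<Rightarrow> nat) \<Rightarrow> nat \<Rightarrow> nat \<Rightarrow> real" where
  "local_residual n a x i c = (\<Sum>t=1..n. residual a i t c (x t))"

text \<open>
  Only the pairs that contain \<open>i\<close> change; in the sum over ordered pairs each of them occurs twice.
\<close>

lemma inversions_update:
  assumes i: "i \<in> {1..n}"
  shows "real (inversions n x) - real (inversions n (x(i := c)))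
    = (\<Sum>t=1..n. beats i t (x i) (x t) - beats i t c (x t))"
proof -
  define G where "G = (\<lambda>s t. beats s t (x s) (x t) - beats s t ((x(i := c)) s) ((x(i := c)) t))"
  have sym: "G s t = G t s" for s t by (simp add: G_def beats_sym[of s t])
  have G0: "G s t = 0" if "s \<noteq> i" "t \<noteq> i" for s t using that by (simp add: G_def)
  have Gii: "G i i = 0" by (simp add: G_def beats_def)
  have "2 * (real (inversions n x) - real (inversions n (x(i := c)))) = (\<Sum>s=1..n. \<Sum>t=1..n. G s t)"
    by (simp add: right_diff_distrib inversions_beats G_def sum_subtractf del: fun_upd_apply)
  also have "\<dots> = (\<Sum>t=1..n. G i t) + (\<Sum>s\<in>{1..n} - {i}. \<Sum>t=1..n. G s t)"
    using i by (subst sum.remove[of _ i]) auto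
  also have "(\<Sum>s\<in>{1..n} - {i}. \<Sum>t=1..n. G s t) = (\<Sum>s\<in>{1..n} - {i}. G i s)"
  proof (rule sum.cong)
    fix s assume s: "s \<in> {1..n} - {i}"
    have "(\<Sum>t=1..n. G s t) = (\<Sum>t\<in>{i}. G s t)"
      using s i G0 by (intro sum.mono_neutral_right) auto
    then show "(\<Sum>t=1..n. G s t) = G i s" by (simp add: sym)
  qed simp
  also have "\<dots> = (\<Sum>s=1..n. G i s)"
    using i Gii by (subst (2) sum.remove[of _ i]) auto
  also have "\<dots> = (\<Sum>t=1..n. beats i t (x i) (x t) - beats i t c (x t))"
    by (rule sum.cong) (auto simp: G_def beats_def)
  finally show ?thesis by (simp del: fun_upd_apply)
qed

lemma abs_inversions_update_le:
  assumes i: "i \<in> {1..n}"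
  shows "\<bar>real (inversions n x) - real (inversions n (x(i := c)))\<bar> \<le> real n - 1"
proof -
  have "\<bar>\<Sum>t=1..n. beats i t (x i) (x t) - beats i t c (x t)\<bar> \<le> (\<Sum>t=1..n. of_bool (t \<noteq> i))"
    by (rule order_trans[OF sum_abs sum_mono]) (auto simp: beats_def)
  also have "\<dots> = (\<Sum>t\<in>{1..n} - {i}. 1)"
    by (rule sum.mono_neutral_cong_right) auto
  also have "\<dots> = real n - 1" using i by (simp add: of_nat_diff)
  finally show ?thesis by (simp only: inversions_update[OF i])
qed

lemma inversions_update_decomp:
  assumes i: "i \<in> {1..n}"
  shows "real (inversions n x) - real (inversions n (x(i := c)))
    = position_weight n i * (centred a (x i) - centred a c)
      + (local_residual n a x i (x i) - local_residual n a x i c)"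
proof -
  have "(\<Sum>t=1..n. beats i t (x i) (x t) - beats i t c (x t))
      = (\<Sum>t=1..n. sgn (real t - real i) * (centred a (x i) - centred a c)
          + (residual a i t (x i) (x t) - residual a i t c (x t)))"
    by (rule sum.cong) (simp_all add: beats_decomp[where a = a] algebra_simps)
  also have "\<dots> = (\<Sum>t=1..n. sgn (real t - real i)) * (centred a (x i) - centred a c)
          + (local_residual n a x i (x i) - local_residual n a x i c)"
    by (simp only: sum.distrib sum_distrib_right[symmetric] sum_subtractf local_residual_def)
  finally show ?thesis by (simp only: inversions_update[OF i] sum_sgn_position[OF i])
qed

lemma mean_local_residual:
  assumes "x \<in> words n a"
  shows "mean {1..a} (local_residual n a x i) = 0"
  unfolding local_residual_def[abs_def] mean_sum
  by (rule sum.neutral) (use mean_residual[OF word_letter[OF assms]] in auto)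

text \<open>
  A term of the linear part is destroyed by resampling at its one position, but a term of the
  degenerate part at either of its two positions. Hence the factor \<open>2\<close>.
\<close>

lemma inversions_drift:
  assumes x: "x \<in> words n a" and a: "a > 0"
  shows "mean {1..n} (\<lambda>i. mean {1..a} (\<lambda>c. real (inversions n x) - real (inversions n (x(i := c)))))
    = (linear_part n a x + 2 * degenerate_part n a x) / real n"
proof -
  have "mean {1..a} (\<lambda>c. real (inversions n x) - real (inversions n (x(i := c))))
     = position_weight n i * centred a (x i) + local_residual n a x i (x i)" if "i \<in> {1..n}" for i
    using a mean_centred[of a] unfolding inversions_update_decomp[OF that, where a = a]
    by (simp add: mean_add mean_diff mean_cmult mean_const mean_local_residual[OF x])
  then have "mean {1..n} (\<lambda>i. mean {1..a} (\<lambda>c. real (inversions n x) - real (inversions n (x(i := c)))))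
     = mean {1..n} (\<lambda>i. position_weight n i * centred a (x i) + local_residual n a x i (x i))"
    by (intro mean_cong)
  also have "\<dots> = (linear_part n a x + (\<Sum>i=1..n. local_residual n a x i (x i))) / real n"
    by (simp add: mean_def sum.distrib linear_part_def)
  finally show ?thesis by (simp only: local_residual_def sum_residual)
qed

section \<open>Moments of the parts\<close>

lemma abs_position_weight_le: "i \<in> {1..n} \<Longrightarrow> \<bar>position_weight n i\<bar> \<le> real n"
  by (auto simp: position_weight_def)

lemma mean_abs_linear_part_le:
  assumes a: "a > 0"
  shows "mean (words n a) (\<lambda>x. \<bar>linear_part n a x\<bar>) \<le> sqrt n * real n"
proof -
  have "mean (words n a) (\<lambda>x. \<bar>\<Sum>i\<in>{1..n}. position_weight n i * centred a (x i)\<bar>)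
      \<le> sqrt (card {1..n}) * n"
  proof (rule orthogonal_sum_first_moment[OF finite_words words_nonempty[OF a]])
    fix i j assume ij: "i \<in> {1..n}" "j \<in> {1..n}" "i \<noteq> j"
    show "mean (words n a) (\<lambda>x. position_weight n i * centred a (x i) *
        (position_weight n j * centred a (x j))) = 0"
      using ij mean_centred[of a]
      by (intro mean_words_eq_0[OF ij(1) a]) (simp add: mean_cmult mean_cmult_right)
  next
    fix i x assume ix: "i \<in> {1..n}" "x \<in> words n a"
    have "\<bar>position_weight n i\<bar> * \<bar>centred a (x i)\<bar> \<le> real n * 1"
      using abs_position_weight_le[OF ix(1)] abs_centred_le[OF word_letter[OF ix(2,1)]]
      by (intro mult_mono) auto
    then show "\<bar>position_weight n i * centred a (x i)\<bar> \<le> real n" by (simp add: abs_mult)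
  qed auto
  then show ?thesis by (simp add: linear_part_def)
qed

text \<open>
  Of two different pairs of positions, the first has a position that the second lacks. Averaging
  over the letter there shows that their terms are orthogonal. There are about \<open>n\<^sup>2\<close> terms, so the sum
  is of order \<open>n\<close>.
\<close>

lemma mean_abs_degenerate_part_le:
  assumes a: "a > 0"
  shows "mean (words n a) (\<lambda>x. \<bar>degenerate_part n a x\<bar>) \<le> 2 * real n"
proof -
  have "mean (words n a) (\<lambda>x. \<bar>\<Sum>p\<in>ordered_pairs n. residual a (fst p) (snd p) (x (fst p)) (x (snd p))\<bar>)
      \<le> sqrt (card (ordered_pairs n)) * 2"
  proof (rule orthogonal_sum_first_moment[OF finite_words words_nonempty[OF a] finite_ordered_pairs])
    fix p q assume pq: "p \<in> ordered_pairs n" "q \<in> ordered_pairs n" "p \<noteq> q"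
    obtain i t k l where [simp]: "p = (i, t)" "q = (k, l)" by (cases p, cases q)
    have r: "i \<in> {1..n}" "t \<in> {1..n}" "i \<noteq> t" "k \<in> {1..n}" "l \<in> {1..n}"
      using pq by (auto simp: ordered_pairs_def)
    show "mean (words n a) (\<lambda>x. residual a (fst p) (snd p) (x (fst p)) (x (snd p)) *
       residual a (fst q) (snd q) (x (fst q)) (x (snd q))) = 0"
    proof (cases "i \<in> {k, l}")
      case False
      then show ?thesis using r mean_residual[OF word_letter]
        by (intro mean_words_eq_0[OF r(1) a]) (simp add: mean_cmult_right)
    next
      case True
      then have "t \<notin> {k, l}" using pq by (auto simp: ordered_pairs_def)
      then show ?thesis using r mean_residual[OF word_letter]
        by (intro mean_words_eq_0[OF r(2) a]) (simp add: mean_cmult_right residual_sym[of a i t])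
    qed
  next
    fix p x assume p: "p \<in> ordered_pairs n" and x: "x \<in> words n a"
    then have "fst p \<in> {1..n}" "snd p \<in> {1..n}" by (auto simp: ordered_pairs_def)
    then show "\<bar>residual a (fst p) (snd p) (x (fst p)) (x (snd p))\<bar> \<le> 2"
      by (intro abs_residual_le word_letter[OF x])
  qed auto
  also have "sqrt (card (ordered_pairs n)) \<le> n"
    using card_ordered_pairs_le[of n] by (intro real_le_lsqrt) (auto simp flip: of_nat_power)
  finally show ?thesis by (simp add: degenerate_part_def case_prod_unfold)
qed

lemma mean_local_residual_sq_le:
  assumes a: "a > 0" and i: "i \<in> {1..n}" and c: "c \<in> {1..a}"
  shows "mean (words n a) (\<lambda>x. (local_residual n a x i (x i) - local_residual n a x i c)\<^sup>2) \<le> 16 * real n"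
proof -
  have "mean (words n a) (\<lambda>x. (\<Sum>t\<in>{1..n}. residual a i t (x i) (x t) - residual a i t c (x t))\<^sup>2)
      \<le> real (card {1..n}) * 4\<^sup>2"
  proof (rule orthogonal_sum_second_moment[OF finite_words words_nonempty[OF a]])
    fix t u assume tu: "t \<in> {1..n}" "u \<in> {1..n}" "t \<noteq> u"
    show "mean (words n a) (\<lambda>x. (residual a i t (x i) (x t) - residual a i t c (x t)) *
       (residual a i u (x i) (x u) - residual a i u c (x u))) = 0"
    proof (cases "t = i")
      case True
      then show ?thesis by (simp add: mean_def)
    next
      case False
      then show ?thesis using i c tu mean_residual[OF word_letter] mean_residual[OF c]
        by (intro mean_words_eq_0[OF tu(1) a])
           (simp add: mean_cmult_right mean_diff residual_sym[of a i t])
    qed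
  next
    fix t x assume t: "t \<in> {1..n}" and x: "x \<in> words n a"
    have "\<bar>residual a i t (x i) (x t)\<bar> \<le> 2" "\<bar>residual a i t c (x t)\<bar> \<le> 2"
      by (intro abs_residual_le word_letter[OF x] i t c)+
    then show "\<bar>residual a i t (x i) (x t) - residual a i t c (x t)\<bar> \<le> 4" by linarith
  qed auto
  then show ?thesis by (simp add: local_residual_def sum_subtractf)
qed

section \<open>The conditional variance of a resampling step\<close>

text \<open>
  The asymptotic variance of the number of inversions, divided by \<open>n ^ 3\<close>. It is a third of the
  variance of a centred letter, since the squares of the position weights add up to about \<open>n ^ 3 / 3\<close>.
\<close>

definition riffle_variance :: "nat \<Rightarrow> real" where
  "riffle_variance a = ((real a)\<^sup>2 - 1) / (36 * (real a)\<^sup>2)"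

lemma riffle_variance_pos: "a \<ge> 2 \<Longrightarrow> riffle_variance a > 0"
  using power_mono[of 2 "real a" 2] by (simp add: riffle_variance_def)

lemma riffle_variance_le: "riffle_variance a \<le> 1 / 36"
  by (cases "a = 0") (auto simp: riffle_variance_def field_simps)

lemma mean_centred_sq':
  "a > 0 \<Longrightarrow> mean {1..a} (\<lambda>c. (centred a c)\<^sup>2) = 3 * riffle_variance a"
  by (simp add: mean_centred_sq riffle_variance_def field_simps)

lemma sum_position_weight_sq: "(\<Sum>i=1..n. (position_weight n i)\<^sup>2) = real n * ((real n)\<^sup>2 - 1) / 3"
proof -
  have "(\<Sum>i=1..n. (position_weight n i)\<^sup>2)
      = (\<Sum>i=1..n. (real n + 1)\<^sup>2 - 4 * (real n + 1) * real i + 4 * (real i)\<^sup>2)"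
    by (simp add: position_weight_def power2_eq_square algebra_simps)
  also have "\<dots> = real n * ((real n)\<^sup>2 - 1) / 3"
    by (simp add: sum.distrib sum_subtractf sum_distrib_left[symmetric] sum_of_nat_1
        sum_of_nat_squares_1) (simp add: field_simps power2_eq_square)
  finally show ?thesis .
qed

text \<open>
  Up to a factor \<open>2\<close>, this sum is the random part of the leading term of \<open>resampling_variance\<close>. As a sum of independent terms of
  order \<open>n\<^sup>2\<close>, centred, it is smaller by a factor \<open>sqrt n\<close> than the constant part of that term.
\<close>

lemma mean_abs_square_fluctuation_le:
  assumes a: "a > 0"
  shows "mean (words n a) (\<lambda>x. \<bar>\<Sum>i=1..n. (position_weight n i)\<^sup>2 * ((centred a (x i))\<^sup>2 - 3 * riffle_variance a)\<bar>)
    \<le> sqrt n * (real n)\<^sup>2"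
proof -
  let ?g = "\<lambda>c. (centred a c)\<^sup>2 - 3 * riffle_variance a"
  have g0: "mean {1..a} ?g = 0" using a by (simp add: mean_diff mean_const mean_centred_sq')
  have "mean (words n a) (\<lambda>x. \<bar>\<Sum>i\<in>{1..n}. (position_weight n i)\<^sup>2 * ?g (x i)\<bar>)
      \<le> sqrt (card {1..n}) * (real n)\<^sup>2"
  proof (rule orthogonal_sum_first_moment[OF finite_words words_nonempty[OF a]])
    fix i j assume ij: "i \<in> {1..n}" "j \<in> {1..n}" "i \<noteq> j"
    show "mean (words n a) (\<lambda>x. (position_weight n i)\<^sup>2 * ?g (x i) *
        ((position_weight n j)\<^sup>2 * ?g (x j))) = 0"
      using ij g0
      by (intro mean_words_eq_0[OF ij(1) a]) (simp add: mean_cmult mean_cmult_right)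
  next
    fix i x assume i: "i \<in> {1..n}" and x: "x \<in> words n a"
    have c: "x i \<in> {1..a}" by (rule word_letter[OF x i])
    have "(centred a (x i))\<^sup>2 \<le> 1"
      using abs_centred_le[OF c] by (simp add: abs_square_le_1)
    moreover have "0 \<le> mean {1..a} (\<lambda>c. (centred a c)\<^sup>2)" by (rule mean_nonneg) simp
    then have "0 \<le> riffle_variance a" using a by (simp add: mean_centred_sq')
    ultimately have "\<bar>?g (x i)\<bar> \<le> 1"
      using riffle_variance_le[of a] zero_le_power2[of "centred a (x i)"] unfolding abs_le_iff by linarith
    moreover have "(position_weight n i)\<^sup>2 \<le> (real n)\<^sup>2"
      using abs_position_weight_le[OF i] by (simp add: abs_le_square_iff[symmetric])
    ultimately have "(position_weight n i)\<^sup>2 * \<bar>?g (x i)\<bar> \<le> (real n)\<^sup>2 * 1"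
      by (intro mult_mono) auto
    then show "\<bar>(position_weight n i)\<^sup>2 * ?g (x i)\<bar> \<le> (real n)\<^sup>2" by (simp add: abs_mult)
  qed auto
  then show ?thesis by simp
qed

text \<open>
  This is \<open>n / 2\<close> times the conditional second moment of the change that resampling makes to the
  number of inversions.
\<close>

definition resampling_variance :: "nat \<Rightarrow> nat \<Rightarrow> (nat \<Rightarrow> nat) \<Rightarrow> real" where
  "resampling_variance n a x =
     (\<Sum>i=1..n. mean {1..a} (\<lambda>c. (real (inversions n x) - real (inversions n (x(i := c))))\<^sup>2)) / 2"

text \<open>
  Here \<open>B\<close> is the part of the change that comes from the degenerate part. Expanding the square of the
  change gives a linear square, whose mean nearly matches the normalisation and whose fluctuation is the
  second term on the right, a cross term and the square of \<open>B\<close>. As \<open>B\<close> is only of order \<open>sqrt n\<close>, the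
  triangle inequality suffices for the last two.
\<close>

lemma abs_resampling_variance_diff_le:
  fixes x :: "nat \<Rightarrow> nat"
  assumes a: "a > 0" and n: "n \<ge> 1" and x: "x \<in> words n a"
  defines "B \<equiv> \<lambda>i c. local_residual n a x i (x i) - local_residual n a x i c"
  shows "\<bar>real n * (real n - 1)\<^sup>2 * riffle_variance a - resampling_variance n a x\<bar> \<le> (real n)\<^sup>2
    + 1 / 2 * \<bar>\<Sum>i=1..n. (position_weight n i)\<^sup>2 * ((centred a (x i))\<^sup>2 - 3 * riffle_variance a)\<bar>
    + real n * (\<Sum>i=1..n. mean {1..a} (\<lambda>c. \<bar>B i c\<bar>))
    + 1 / 2 * (\<Sum>i=1..n. mean {1..a} (\<lambda>c. (B i c)\<^sup>2))"
proof -
  let ?w = "position_weight n" and ?h = "centred a" and ?v = "riffle_variance a"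
  let ?cross = "\<lambda>i. mean {1..a} (\<lambda>c. (?h (x i) - ?h c) * B i c)"
  have sq: "mean {1..a} (\<lambda>c. (?h (x i) - ?h c)\<^sup>2) = (?h (x i))\<^sup>2 + 3 * ?v" for i
  proof -
    have "mean {1..a} (\<lambda>c. (?h (x i) - ?h c)\<^sup>2)
        = mean {1..a} (\<lambda>c. (?h (x i))\<^sup>2 + (?h c)\<^sup>2 - (2 * ?h (x i)) * ?h c)"
      by (simp add: power2_diff)
    also have "\<dots> = (?h (x i))\<^sup>2 + 3 * ?v - 2 * ?h (x i) * mean {1..a} ?h"
      unfolding mean_diff mean_add mean_cmult using a by (simp add: mean_const mean_centred_sq')
    finally show ?thesis by (simp add: mean_centred)
  qed
  have each: "mean {1..a} (\<lambda>c. (real (inversions n x) - real (inversions n (x(i := c))))\<^sup>2)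
      = (?w i)\<^sup>2 * ((?h (x i))\<^sup>2 + 3 * ?v) + 2 * (?w i * ?cross i) + mean {1..a} (\<lambda>c. (B i c)\<^sup>2)"
    if i: "i \<in> {1..n}" for i
  proof -
    have "mean {1..a} (\<lambda>c. (real (inversions n x) - real (inversions n (x(i := c))))\<^sup>2)
        = mean {1..a} (\<lambda>c. (?w i)\<^sup>2 * (?h (x i) - ?h c)\<^sup>2
            + (2 * ?w i) * ((?h (x i) - ?h c) * B i c) + (B i c)\<^sup>2)"
      unfolding inversions_update_decomp[OF i, where a = a] B_def
      by (simp add: power2_sum power_mult_distrib mult_ac add_ac)
    also have "\<dots> = (?w i)\<^sup>2 * ((?h (x i))\<^sup>2 + 3 * ?v) + 2 * ?w i * ?cross i + mean {1..a} (\<lambda>c. (B i c)\<^sup>2)"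
      unfolding mean_add mean_cmult sq ..
    finally show ?thesis by (simp add: mult.assoc)
  qed
  have "resampling_variance n a x
     = (\<Sum>i=1..n. (?w i)\<^sup>2 * ((?h (x i))\<^sup>2 + 3 * ?v) + 2 * (?w i * ?cross i) + mean {1..a} (\<lambda>c. (B i c)\<^sup>2)) / 2"
    unfolding resampling_variance_def by (simp only: each cong: sum.cong)
  also have "\<dots> = (\<Sum>i=1..n. 6 * ?v * (?w i)\<^sup>2 + (?w i)\<^sup>2 * ((?h (x i))\<^sup>2 - 3 * ?v)
       + 2 * (?w i * ?cross i) + mean {1..a} (\<lambda>c. (B i c)\<^sup>2)) / 2"
    by (simp add: algebra_simps)
  also have "\<dots> = 3 * ?v * (\<Sum>i=1..n. (?w i)\<^sup>2) + 1 / 2 * (\<Sum>i=1..n. (?w i)\<^sup>2 * ((?h (x i))\<^sup>2 - 3 * ?v))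
      + (\<Sum>i=1..n. ?w i * ?cross i) + 1 / 2 * (\<Sum>i=1..n. mean {1..a} (\<lambda>c. (B i c)\<^sup>2))"
    unfolding sum.distrib sum_distrib_left[symmetric] by simp
  finally have V: "resampling_variance n a x = \<dots>" .
  \<comment> \<open>The sum of the squared weights contains the factor \<open>(n - 1) * (n + 1)\<close> instead of
    \<open>(n - 1)\<^sup>2\<close>; this changes only a lower order term.\<close>
  have main: "\<bar>real n * (real n - 1)\<^sup>2 * ?v - 3 * ?v * (\<Sum>i=1..n. (?w i)\<^sup>2)\<bar> \<le> (real n)\<^sup>2"
  proof -
    have "0 \<le> mean {1..a} (\<lambda>c. (centred a c)\<^sup>2)" by (rule mean_nonneg) simp
    then have v: "0 \<le> ?v" using a by (simp add: mean_centred_sq')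
    have "real n * (real n - 1)\<^sup>2 * ?v - 3 * ?v * (\<Sum>i=1..n. (?w i)\<^sup>2)
        = - (2 * ?v * (real n * (real n - 1)))"
      unfolding sum_position_weight_sq by (simp add: field_simps power2_eq_square)
    moreover have "2 * ?v * (real n * (real n - 1)) \<le> 1 * (real n * real n)"
      using riffle_variance_le[of a] n v by (intro mult_mono) auto
    moreover have "0 \<le> 2 * ?v * (real n * (real n - 1))" using v n by simp
    ultimately show ?thesis by (simp add: power2_eq_square)
  qed
  have cross: "\<bar>\<Sum>i=1..n. ?w i * ?cross i\<bar> \<le> real n * (\<Sum>i=1..n. mean {1..a} (\<lambda>c. \<bar>B i c\<bar>))"
    unfolding sum_distrib_left
  proof (rule order_trans[OF sum_abs sum_mono])
    fix i assume i: "i \<in> {1..n}"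
    have "\<bar>?cross i\<bar> \<le> mean {1..a} (\<lambda>c. \<bar>B i c\<bar>)"
    proof (rule order_trans[OF mean_abs_le mean_mono])
      fix c assume c: "c \<in> {1..a}"
      have "\<bar>?h (x i) - ?h c\<bar> \<le> 1"
        using abs_centred_le[OF c] abs_centred_le[OF word_letter[OF x i]] by linarith
      from mult_right_mono[OF this, of "\<bar>B i c\<bar>"]
      show "\<bar>(?h (x i) - ?h c) * B i c\<bar> \<le> \<bar>B i c\<bar>" by (simp add: abs_mult)
    qed
    then show "\<bar>?w i * ?cross i\<bar> \<le> real n * mean {1..a} (\<lambda>c. \<bar>B i c\<bar>)"
      unfolding abs_mult by (intro mult_mono abs_position_weight_le i) auto
  qed
  have "0 \<le> (\<Sum>i=1..n. mean {1..a} (\<lambda>c. (B i c)\<^sup>2))"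
    by (intro sum_nonneg mean_nonneg) simp
  then show ?thesis using main cross unfolding V by linarith
qed

lemma mean_abs_resampling_variance_diff_le:
  assumes a: "a > 0" and n: "n \<ge> 1"
  shows "mean (words n a) (\<lambda>x. \<bar>real n * (real n - 1)\<^sup>2 * riffle_variance a - resampling_variance n a x\<bar>)
    \<le> 14 * ((real n)\<^sup>2 * sqrt n)"
proof -
  note W = finite_words words_nonempty[OF a]
  have ne: "{1..a} \<noteq> {}" using a by auto
  let ?B = "\<lambda>x i c. local_residual n a x i (x i) - local_residual n a x i c"
  have B2: "mean (words n a) (\<lambda>x. mean {1..a} (\<lambda>c. (?B x i c)\<^sup>2)) \<le> 16 * real n"
    if "i \<in> {1..n}" for i
    unfolding mean_swap[of "words n a"]
    by (rule mean_le_const) (use mean_local_residual_sq_le[OF a that] ne in auto)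
  have B1: "mean (words n a) (\<lambda>x. mean {1..a} (\<lambda>c. \<bar>?B x i c\<bar>)) \<le> 4 * sqrt n"
    if i: "i \<in> {1..n}" for i
    unfolding mean_swap[of "words n a"]
  proof (rule mean_le_const)
    fix c assume c: "c \<in> {1..a}"
    have "mean (words n a) (\<lambda>x. \<bar>?B x i c\<bar>) \<le> sqrt (mean (words n a) (\<lambda>x. (?B x i c)\<^sup>2))"
      by (rule mean_abs_le_sqrt[OF W])
    also have "\<dots> \<le> sqrt (16 * real n)"
      by (rule real_sqrt_le_mono[OF mean_local_residual_sq_le[OF a i c]])
    finally show "mean (words n a) (\<lambda>x. \<bar>?B x i c\<bar>) \<le> 4 * sqrt n"
      by (simp add: real_sqrt_mult)
  qed (use ne in auto)
  let ?f = "\<lambda>x. \<bar>\<Sum>i=1..n. (position_weight n i)\<^sup>2 * ((centred a (x i))\<^sup>2 - 3 * riffle_variance a)\<bar>"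
  have "mean (words n a) (\<lambda>x. \<bar>real n * (real n - 1)\<^sup>2 * riffle_variance a - resampling_variance n a x\<bar>)
     \<le> mean (words n a) (\<lambda>x. (real n)\<^sup>2 + 1 / 2 * ?f x
        + real n * (\<Sum>i=1..n. mean {1..a} (\<lambda>c. \<bar>?B x i c\<bar>))
        + 1 / 2 * (\<Sum>i=1..n. mean {1..a} (\<lambda>c. (?B x i c)\<^sup>2)))"
    by (intro mean_mono abs_resampling_variance_diff_le a n)
  also have "\<dots> = (real n)\<^sup>2 + 1 / 2 * mean (words n a) ?f
        + real n * (\<Sum>i=1..n. mean (words n a) (\<lambda>x. mean {1..a} (\<lambda>c. \<bar>?B x i c\<bar>)))
        + 1 / 2 * (\<Sum>i=1..n. mean (words n a) (\<lambda>x. mean {1..a} (\<lambda>c. (?B x i c)\<^sup>2)))"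
    unfolding mean_add mean_cmult mean_sum mean_const[OF W] ..
  also have "\<dots> \<le> (real n)\<^sup>2 + 1 / 2 * (sqrt n * (real n)\<^sup>2)
        + real n * (\<Sum>i=1..n. 4 * sqrt n) + 1 / 2 * (\<Sum>i=1..n. 16 * real n)"
    by (intro add_mono mult_left_mono sum_mono B1 B2 mean_abs_square_fluctuation_le a) auto
  also have "\<dots> = 9 * (real n)\<^sup>2 + 9 / 2 * ((real n)\<^sup>2 * sqrt n)"
    by (simp add: power2_eq_square algebra_simps)
  also have "\<dots> \<le> 14 * ((real n)\<^sup>2 * sqrt n)"
  proof -
    have "(real n)\<^sup>2 * 1 \<le> (real n)\<^sup>2 * sqrt n" using n by (intro mult_left_mono) auto
    moreover have "0 \<le> (real n)\<^sup>2" by simp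
    ultimately show ?thesis by linarith
  qed
  finally show ?thesis .
qed

section \<open>Normal approximation for random words\<close>

text \<open>
  The bound for exchangeable pairs with \<open>lam = 1 / n\<close>. A letter changes the number of inversions by
  at most \<open>n - 1\<close>, which explains the factor \<open>n - 1\<close> in the normalisation: the jumps become at
  most \<open>1 / (sqrt n * sqrt (riffle_variance a))\<close>.
\<close>

lemma word_inversions_normal_bound:
  assumes a: "a \<ge> 2" and n: "n \<ge> 2" and c: "\<And>w. stein_sol z w \<le> c"
  defines "s \<equiv> sqrt (real n) * (real n - 1) * sqrt (riffle_variance a)"
  defines "m \<equiv> real n * (real n - 1) / 4 * ((real a - 1) / real a)"
  shows "\<bar>mean (words n a) (\<lambda>x. of_bool ((real (inversions n x) - m) / s \<le> z)) - \<Phi> z\<bar>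
    \<le> (132 / riffle_variance a + 4 * c / sqrt (riffle_variance a)) / sqrt (real n)"
proof -
  let ?S = "words n a" and ?v = "riffle_variance a" and ?r = "sqrt (real n)"
  define W where "W = (\<lambda>x. (real (inversions n x) - m) / s)"
  define R where "R = (\<lambda>x. degenerate_part n a x / s)"
  define Y where "Y = (\<lambda>(x :: nat \<Rightarrow> nat) (i, c). x(i := c :: nat))"
  define K where "K = {1..n} \<times> {1..a}"
  define q where "q = sqrt ?v"
  have a0: "a > 0" and n1: "n \<ge> 1" using a n by auto
  note S = finite_words words_nonempty[OF a0]
  have v: "?v > 0" by (rule riffle_variance_pos[OF a])
  have q: "q > 0" "q * q = ?v" using v by (auto simp: q_def)
  have r: "?r \<ge> 1" "?r * ?r = n" using n by auto
  have c0: "0 \<le> c" using c[of 0] stein_sol_nonneg[of z 0] by simp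
  have s: "s = ?r * (real n - 1) * q" by (simp add: s_def q_def)
  have "real n \<le> 2 * (real n - 1)" using n by simp
  then have s_ge: "?r * n * q / 2 \<le> s"
    using r q unfolding s by (simp add: mult_ac mult_left_mono)
  have s_pos: "s > 0" using n q by (simp add: s)
  have s_sq: "s\<^sup>2 = real n * (real n - 1)\<^sup>2 * ?v"
    using v by (simp add: s_def power_mult_distrib)
  have W_diff: "W x - W y = (real (inversions n x) - real (inversions n y)) / s" for x y
    by (simp add: W_def diff_divide_distrib)
  have WR: "W x + R x = (linear_part n a x + 2 * degenerate_part n a x) / s" for x
    using hoeffding_decomposition[of n x a] by (simp add: W_def R_def m_def add_divide_distrib[symmetric])
  have Y: "mean K (\<lambda>k. F (Y x k)) = mean {1..n} (\<lambda>i. mean {1..a} (\<lambda>c. F (x(i := c))))" for F x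
    by (simp add: K_def Y_def mean_Times)
  have bound: "\<bar>mean ?S (\<lambda>x. of_bool (W x \<le> z)) - \<Phi> z\<bar>
    \<le> 2 * mean ?S (\<lambda>x. \<bar>1 - mean K (\<lambda>k. (W x - W (Y x k))\<^sup>2) / (2 * (1 / n))\<bar>)
      + c * mean ?S (\<lambda>x. \<bar>R x\<bar>) + 2 * (1 / (?r * q)) * mean ?S (\<lambda>x. \<bar>W x + R x\<bar>)"
  proof (rule exchangeable_pair_normal_bound[OF S])
    show "finite K" "K \<noteq> {}" using a0 n1 by (auto simp: K_def)
    show "mean ?S (\<lambda>x. mean K (\<lambda>k. F x (Y x k))) = mean ?S (\<lambda>x. mean K (\<lambda>k. F (Y x k) x))" for F
    proof -
      have "mean ?S (\<lambda>x. mean K (\<lambda>k. F x (Y x k)))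
          = mean {1..n} (\<lambda>i. mean ?S (\<lambda>x. mean {1..a} (\<lambda>c. F x (x(i := c)))))"
        by (subst mean_swap[symmetric]) (simp only: Y)
      also have "\<dots> = mean {1..n} (\<lambda>i. mean ?S (\<lambda>x. mean {1..a} (\<lambda>c. F (x(i := c)) x)))"
        by (intro mean_cong resample_exchangeable)
      also have "\<dots> = mean ?S (\<lambda>x. mean K (\<lambda>k. F (Y x k) x))"
        by (subst mean_swap[symmetric]) (simp add: K_def Y_def mean_Times)
      finally show ?thesis .
    qed
    show "mean K (\<lambda>k. W x - W (Y x k)) = 1 / real n * (W x + R x)" if "x \<in> ?S" for x
      unfolding WR W_diff mean_divide Y[of "\<lambda>y. real (inversions n x) - real (inversions n y)"]
        inversions_drift[OF that a0] by simp
    show "\<bar>W x - W (Y x k)\<bar> \<le> 1 / (?r * q)" if x: "x \<in> ?S" and k: "k \<in> K" for x k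
    proof -
      obtain i d where id: "k = (i, d)" "i \<in> {1..n}" using k by (auto simp: K_def)
      have "\<bar>W x - W (Y x k)\<bar> \<le> (real n - 1) / s"
        using abs_inversions_update_le[OF id(2), of x d] s_pos
        by (simp add: W_diff Y_def id(1) abs_divide divide_right_mono)
      also have "\<dots> = 1 / (?r * q)" using n by (simp add: s)
      finally show ?thesis .
    qed
    show "0 < 1 / real n" using n by simp
    show "stein_sol z w \<le> c" for w by (rule c)
  qed
  have var: "mean ?S (\<lambda>x. \<bar>1 - mean K (\<lambda>k. (W x - W (Y x k))\<^sup>2) / (2 * (1 / n))\<bar>) \<le> 56 / ?v / ?r"
  proof -
    have eq: "1 - mean K (\<lambda>k. (W x - W (Y x k))\<^sup>2) / (2 * (1 / n))
        = (s\<^sup>2 - resampling_variance n a x) / s\<^sup>2" for x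
    proof -
      have "mean K (\<lambda>k. (W x - W (Y x k))\<^sup>2) = 2 * resampling_variance n a x / n / s\<^sup>2"
        unfolding W_diff power_divide mean_divide
          Y[of "\<lambda>y. (real (inversions n x) - real (inversions n y))\<^sup>2"]
        by (simp add: resampling_variance_def mean_def[of "{1..n}"])
      then show ?thesis using s_pos n1 by (simp add: diff_divide_distrib)
    qed
    have "mean ?S (\<lambda>x. \<bar>1 - mean K (\<lambda>k. (W x - W (Y x k))\<^sup>2) / (2 * (1 / n))\<bar>)
        = mean ?S (\<lambda>x. \<bar>s\<^sup>2 - resampling_variance n a x\<bar>) / s\<^sup>2"
      unfolding eq abs_divide mean_divide by simp
    also have "\<dots> \<le> 14 * ((real n)\<^sup>2 * ?r) / (?r * n * q / 2)\<^sup>2"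
      using mean_abs_resampling_variance_diff_le[OF a0 n1] s_ge q r n1 unfolding s_sq[symmetric]
      by (intro frac_le power_mono) auto
    also have "\<dots> = 56 / ?v / ?r"
      using n1 q(1) r(1) by (simp add: q(2)[symmetric] power2_eq_square field_simps)
    finally show ?thesis .
  qed
  have deg: "mean ?S (\<lambda>x. \<bar>R x\<bar>) \<le> 4 / q / ?r"
  proof -
    have "mean ?S (\<lambda>x. \<bar>R x\<bar>) = mean ?S (\<lambda>x. \<bar>degenerate_part n a x\<bar>) / s"
      using s_pos by (simp add: R_def abs_divide mean_divide)
    also have "\<dots> \<le> 2 * n / (?r * n * q / 2)"
      by (rule frac_le) (use mean_abs_degenerate_part_le[OF a0, of n] s_ge q r n1 in simp_all)
    also have "\<dots> = 4 / q / ?r" using n1 q(1) r(1) by (simp add: field_simps)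
    finally show ?thesis .
  qed
  have lin: "mean ?S (\<lambda>x. \<bar>W x + R x\<bar>) \<le> 10 / q"
  proof -
    have "mean ?S (\<lambda>x. \<bar>W x + R x\<bar>) = mean ?S (\<lambda>x. \<bar>linear_part n a x + 2 * degenerate_part n a x\<bar>) / s"
      using s_pos by (simp add: WR abs_divide mean_divide)
    also have "\<dots> \<le> 5 * (?r * n) / (?r * n * q / 2)"
    proof (rule frac_le)
      have "mean ?S (\<lambda>x. \<bar>linear_part n a x + 2 * degenerate_part n a x\<bar>)
          \<le> mean ?S (\<lambda>x. \<bar>linear_part n a x\<bar> + 2 * \<bar>degenerate_part n a x\<bar>)"
        by (intro mean_mono) linarith
      also have "\<dots> \<le> ?r * n + 2 * (2 * real n)"
        unfolding mean_add mean_cmult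
        by (intro add_mono mult_left_mono mean_abs_linear_part_le mean_abs_degenerate_part_le a0) auto
      also have "\<dots> \<le> 5 * (?r * n)"
        using mult_right_mono[OF r(1), of "real n"] by linarith
      finally show "mean ?S (\<lambda>x. \<bar>linear_part n a x + 2 * degenerate_part n a x\<bar>) \<le> 5 * (?r * n)" .
    qed (use s_ge q r n1 in auto)
    also have "\<dots> = 10 / q" using n1 q(1) r(1) by (simp add: field_simps)
    finally show ?thesis .
  qed
  have "\<bar>mean ?S (\<lambda>x. of_bool (W x \<le> z)) - \<Phi> z\<bar>
    \<le> 2 * (56 / ?v / ?r) + c * (4 / q / ?r) + 2 * (1 / (?r * q)) * (10 / q)"
    by (rule order_trans[OF bound], intro add_mono mult_left_mono var deg lin) (use c0 q r in auto)
  \<comment> \<open>\<open>132 = 2 * 56 + 2 * 10\<close>: the conditional variance and the size of the jumps\<close>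
  also have "\<dots> = (132 / ?v + 4 * c / q) / ?r"
    using q(1) r(1) by (simp add: q(2)[symmetric] field_simps)
  finally show ?thesis by (simp add: W_def q_def)
qed

section \<open>The word of pile numbers of a shuffle\<close>

definition words_with_counts :: "nat \<Rightarrow> nat \<Rightarrow> (nat \<Rightarrow> nat) \<Rightarrow> (nat \<Rightarrow> nat) set" where
  "words_with_counts n a b = {x \<in> words n a. \<forall>j\<in>{1..a}. card {s \<in> {1..n}. x s = j} = b j}"

text \<open>
  The rank of position \<open>s\<close> if the positions are sorted by letter and then from left to right. With
  \<open>pile_word\<close> as its inverse, this recovers the shuffled deck from its word of pile numbers.
\<close>

definition standardization :: "nat \<Rightarrow> (nat \<Rightarrow> nat) \<Rightarrow> nat \<Rightarrow> nat" where
  "standardization n x s =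
     (if s \<in> {1..n} then card {t \<in> {1..n}. x t < x s \<or> x t = x s \<and> t \<le> s} else s)"

definition pile_word :: "nat \<Rightarrow> nat \<Rightarrow> (nat \<Rightarrow> nat) \<Rightarrow> (nat \<Rightarrow> nat) \<Rightarrow> (nat \<Rightarrow> nat)" where
  "pile_word n a b \<rho> = (\<lambda>s\<in>{1..n}. THE j. j \<in> {1..a} \<and> \<rho> s \<in> pile b j)"

lemma pile_less:
  assumes "k \<in> pile b i" "l \<in> pile b j" "i < j"
  shows "k < l"
proof -
  have "k \<le> (\<Sum>i=1..i. b i)" using assms by (simp add: pile_def)
  also have "\<dots> \<le> (\<Sum>i=1..<j. b i)" using assms by (intro sum_mono2) auto
  also have "\<dots> < l" using assms by (simp add: pile_def)
  finally show ?thesis .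
qed

lemma pile_unique: "k \<in> pile b i \<Longrightarrow> k \<in> pile b j \<Longrightarrow> i = j"
  using pile_less[of k b i k j] pile_less[of k b j k i] by (cases i j rule: linorder_cases) auto

lemma pile_subset:
  assumes "b \<in> cuts n a" "j \<in> {1..a}"
  shows "pile b j \<subseteq> {1..n}"
proof -
  have "(\<Sum>i=1..j. b i) \<le> (\<Sum>i=1..a. b i)" using assms by (intro sum_mono2) auto
  then show ?thesis using assms by (auto simp: pile_def cuts_def)
qed

lemma pile_exists:
  assumes "b \<in> cuts n a" "k \<in> {1..n}"
  obtains j where "j \<in> {1..a}" "k \<in> pile b j"
proof -
  let ?P = "\<lambda>j. k \<le> (\<Sum>i=1..j. b i)"
  have "?P a" using assms by (simp add: cuts_def)
  then have P: "?P (LEAST j. ?P j)" and le: "(LEAST j. ?P j) \<le> a" by (auto intro: LeastI Least_le)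
  let ?j = "LEAST j. ?P j"
  have "?j \<noteq> 0" using P assms by (intro notI) simp
  then have "\<not> ?P (?j - 1)" by (intro not_less_Least) simp
  moreover have "{1..?j - 1} = {1..<?j}" using \<open>?j \<noteq> 0\<close> by auto
  ultimately have "k \<in> pile b ?j" using P by (simp add: pile_def)
  then show ?thesis using le \<open>?j \<noteq> 0\<close> by (intro that[of ?j]) auto
qed

lemma card_pile: "j \<in> {1..a} \<Longrightarrow> card (pile b j) = b j"
proof -
  assume j: "j \<in> {1..a}"
  then have "{1..j} = insert j {1..<j}" by auto
  then show ?thesis by (simp add: pile_def)
qed

lemma pile_word_eqI: "s \<in> {1..n} \<Longrightarrow> j \<in> {1..a} \<Longrightarrow> \<rho> s \<in> pile b j \<Longrightarrow> pile_word n a b \<rho> s = j"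
  unfolding pile_word_def by (auto intro!: the_equality dest: pile_unique)

lemma pile_word_letter:
  assumes b: "b \<in> cuts n a" and \<rho>: "\<rho> \<in> interleavings n a b" and s: "s \<in> {1..n}"
  shows "pile_word n a b \<rho> s \<in> {1..a}" "\<rho> s \<in> pile b (pile_word n a b \<rho> s)"
proof -
  have "\<rho> s \<in> {1..n}" using \<rho> s permutes_in_image[of \<rho> "{1..n}" s] by (auto simp: interleavings_def)
  from pile_exists[OF b this] obtain j where j: "j \<in> {1..a}" "\<rho> s \<in> pile b j" by blast
  then show "pile_word n a b \<rho> s \<in> {1..a}" "\<rho> s \<in> pile b (pile_word n a b \<rho> s)"
    using pile_word_eqI[of s n j a \<rho> b, OF s j] by auto
qed

text \<open>
  Cards from different piles are ordered as their piles; cards of one pile keep their order.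
\<close>

lemma interleaving_less_iff:
  assumes b: "b \<in> cuts n a" and \<rho>: "\<rho> \<in> interleavings n a b" and s: "s \<in> {1..n}" and t: "t \<in> {1..n}"
  defines "x \<equiv> pile_word n a b \<rho>"
  shows "\<rho> t < \<rho> s \<longleftrightarrow> x t < x s \<or> x t = x s \<and> t < s"
proof -
  note S = pile_word_letter[OF b \<rho> s, folded x_def] and T = pile_word_letter[OF b \<rho> t, folded x_def]
  consider "x t < x s" | "x s < x t" | "x t = x s" by linarith
  then show ?thesis
  proof cases
    case 1
    then show ?thesis using pile_less[OF T(2) S(2)] by simp
  next
    case 2
    then show ?thesis using pile_less[OF S(2) T(2)] by simp
  next
    case 3
    have "strict_mono_on {u. \<rho> u \<in> pile b (x s)} \<rho>"
      using \<rho> S by (auto simp: interleavings_def)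
    then have "\<rho> t < \<rho> s \<longleftrightarrow> t < s" by (rule strict_mono_on_less) (use S T 3 in auto)
    then show ?thesis using 3 by simp
  qed
qed

lemma inversions_pile_word:
  assumes b: "b \<in> cuts n a" and \<rho>: "\<rho> \<in> interleavings n a b"
  shows "inversions n (pile_word n a b \<rho>) = inversions n \<rho>"
proof -
  have "pile_word n a b \<rho> j < pile_word n a b \<rho> i \<longleftrightarrow> \<rho> j < \<rho> i" if "1 \<le> i" "i < j" "j \<le> n" for i j
    using interleaving_less_iff[OF b \<rho>, of i j] that by simp
  then show ?thesis unfolding inversions_def by (intro arg_cong[where f = card]) auto
qed

text \<open>
  As \<open>\<rho>\<close> is a permutation, the label \<open>\<rho> s\<close> is its own rank among all labels, and by
  \<open>interleaving_less_iff\<close> the ranking can be read off the word.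
\<close>

lemma standardization_pile_word:
  assumes b: "b \<in> cuts n a" and \<rho>: "\<rho> \<in> interleavings n a b"
  shows "standardization n (pile_word n a b \<rho>) = \<rho>"
proof
  fix s
  have perm: "\<rho> permutes {1..n}" using \<rho> by (simp add: interleavings_def)
  show "standardization n (pile_word n a b \<rho>) s = \<rho> s"
  proof (cases "s \<in> {1..n}")
    case True
    have "\<rho> s \<in> {1..n}" using True permutes_in_image[OF perm] by simp
    have "\<rho> ` {t \<in> {1..n}. \<rho> t \<le> \<rho> s} = {1..\<rho> s}"
    proof -
      have "\<rho> ` {t \<in> {1..n}. \<rho> t \<le> \<rho> s} = {k \<in> \<rho> ` {1..n}. k \<le> \<rho> s}" by auto
      then show ?thesis using \<open>\<rho> s \<in> {1..n}\<close> by (auto simp: permutes_image[OF perm])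
    qed
    moreover have "inj_on \<rho> {t \<in> {1..n}. \<rho> t \<le> \<rho> s}"
      using permutes_inj_on[OF perm] by (rule inj_on_subset) auto
    ultimately have "card {t \<in> {1..n}. \<rho> t \<le> \<rho> s} = card {1..\<rho> s}"
      by (metis card_image)
    then have card: "card {t \<in> {1..n}. \<rho> t \<le> \<rho> s} = \<rho> s" by simp
    have iff: "\<rho> t \<le> \<rho> s \<longleftrightarrow> pile_word n a b \<rho> t < pile_word n a b \<rho> s \<or>
       pile_word n a b \<rho> t = pile_word n a b \<rho> s \<and> t \<le> s" if "t \<in> {1..n}" for t
      by (subst not_less[symmetric], subst interleaving_less_iff[OF b \<rho> that True]) linarith
    have "{t \<in> {1..n}. \<rho> t \<le> \<rho> s} = {t \<in> {1..n}. pile_word n a b \<rho> t < pile_word n a b \<rho> s \<or>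
       pile_word n a b \<rho> t = pile_word n a b \<rho> s \<and> t \<le> s}"
      by (rule Collect_cong, rule conj_cong[OF refl], rule iff)
    with card show ?thesis using True by (simp only: standardization_def if_True)
  next
    case False
    then show ?thesis using permutes_not_in[OF perm False] by (simp only: standardization_def if_False)
  qed
qed

lemma pile_word_in_words_with_counts:
  assumes b: "b \<in> cuts n a" and \<rho>: "\<rho> \<in> interleavings n a b"
  shows "pile_word n a b \<rho> \<in> words_with_counts n a b"
proof -
  have perm: "\<rho> permutes {1..n}" using \<rho> by (simp add: interleavings_def)
  have "card {s \<in> {1..n}. pile_word n a b \<rho> s = j} = b j" if j: "j \<in> {1..a}" for j
  proof -
    have "{s \<in> {1..n}. pile_word n a b \<rho> s = j} = {s \<in> {1..n}. \<rho> s \<in> pile b j}"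
      using pile_word_letter[OF b \<rho>] pile_word_eqI[OF _ j] by blast
    moreover have "\<rho> ` {s \<in> {1..n}. \<rho> s \<in> pile b j} = pile b j"
    proof -
      have "\<rho> ` {s \<in> {1..n}. \<rho> s \<in> pile b j} = {k \<in> \<rho> ` {1..n}. k \<in> pile b j}" by auto
      then show ?thesis using pile_subset[OF b j] by (auto simp: permutes_image[OF perm])
    qed
    moreover have "inj_on \<rho> {s \<in> {1..n}. \<rho> s \<in> pile b j}"
      using permutes_inj_on[OF perm] by (rule inj_on_subset) auto
    ultimately show ?thesis by (metis card_image card_pile[OF j])
  qed
  moreover have "pile_word n a b \<rho> \<in> words n a"
    using pile_word_letter[OF b \<rho>] by (auto simp: words_def pile_word_def)
  ultimately show ?thesis by (simp add: words_with_counts_def)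
qed

lemma card_letters_less:
  assumes x: "x \<in> words_with_counts n a b" and j: "j \<in> {1..a}"
  shows "card {t \<in> {1..n}. x t < j} = (\<Sum>i=1..<j. b i)"
proof -
  have "{t \<in> {1..n}. x t < j} = (\<Union>i\<in>{1..<j}. {t \<in> {1..n}. x t = i})"
    using x word_letter[of x n a] by (force simp: words_with_counts_def)
  then have "card {t \<in> {1..n}. x t < j} = (\<Sum>i=1..<j. card {t \<in> {1..n}. x t = i})"
    by (simp add: card_UN_disjoint disjoint_iff)
  also have "\<dots> = (\<Sum>i=1..<j. b i)"
    using x j by (intro sum.cong) (auto simp: words_with_counts_def)
  finally show ?thesis .
qed

lemma standardization_in_pile:
  assumes x: "x \<in> words_with_counts n a b" and s: "s \<in> {1..n}"
  shows "standardization n x s \<in> pile b (x s)"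
proof -
  have xs: "x s \<in> {1..a}" using x s word_letter by (auto simp: words_with_counts_def)
  let ?E = "{t \<in> {1..n}. x t = x s \<and> t \<le> s}"
  have "{t \<in> {1..n}. x t < x s \<or> x t = x s \<and> t \<le> s} = {t \<in> {1..n}. x t < x s} \<union> ?E" by auto
  then have "standardization n x s = card ({t \<in> {1..n}. x t < x s} \<union> ?E)"
    using s by (simp only: standardization_def if_True)
  also have "card ({t \<in> {1..n}. x t < x s} \<union> ?E) = card {t \<in> {1..n}. x t < x s} + card ?E"
    by (rule card_Un_disjoint) auto
  finally have std: "standardization n x s = (\<Sum>i=1..<x s. b i) + card ?E"
    by (simp only: card_letters_less[OF x xs])
  have "card ?E \<le> card {t \<in> {1..n}. x t = x s}" by (rule card_mono) auto
  also have "\<dots> = b (x s)" using x xs by (simp add: words_with_counts_def)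
  finally have "card ?E \<le> b (x s)" .
  moreover have "card ?E > 0" using s by (auto simp: card_gt_0_iff)
  moreover have "{1..x s} = insert (x s) {1..<x s}" using xs by auto
  ultimately show ?thesis unfolding pile_def std by simp
qed

lemma standardization_mono:
  assumes s: "s \<in> {1..n}" and t: "t \<in> {1..n}" and less: "x s < x t \<or> x s = x t \<and> s < t"
  shows "standardization n x s < standardization n x t"
proof -
  let ?L = "\<lambda>s. {u \<in> {1..n}. x u < x s \<or> x u = x s \<and> u \<le> s}"
  have "?L s \<subseteq> ?L t" "t \<in> ?L t" "t \<notin> ?L s" using less t by auto
  then have "card (?L s) < card (?L t)" by (intro psubset_card_mono) auto
  then show ?thesis using s t by (simp only: standardization_def if_True)
qed

lemma standardization_in_interleavings:
  assumes b: "b \<in> cuts n a" and x: "x \<in> words_with_counts n a b"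
  shows "standardization n x \<in> interleavings n a b"
proof -
  have xs: "x s \<in> {1..a}" if "s \<in> {1..n}" for s
    using x that word_letter by (auto simp: words_with_counts_def)
  have "standardization n x ` {1..n} \<subseteq> {1..n}"
    using standardization_in_pile[OF x] pile_subset[OF b xs] by blast
  moreover have inj: "inj_on (standardization n x) {1..n}"
  proof (rule inj_onI, rule ccontr)
    fix s t assume st: "s \<in> {1..n}" "t \<in> {1..n}" "standardization n x s = standardization n x t" "s \<noteq> t"
    then have "x s < x t \<or> x s = x t \<and> s < t \<or> x t < x s \<or> x t = x s \<and> t < s" by linarith
    then show False
      using standardization_mono[of s n t x] standardization_mono[of t n s x] st by auto
  qed
  ultimately have "bij_betw (standardization n x) {1..n} {1..n}"
    by (simp add: bij_betw_def endo_inj_surj)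
  then have "standardization n x permutes {1..n}"
    by (rule bij_imp_permutes) (auto simp: standardization_def)
  moreover have "strict_mono_on {s. standardization n x s \<in> pile b j} (standardization n x)" if j: "j \<in> {1..a}" for j
  proof (rule strict_mono_onI)
    fix s t assume st: "s \<in> {s. standardization n x s \<in> pile b j}"
      "t \<in> {s. standardization n x s \<in> pile b j}" "s < t"
    have in_range: "u \<in> {1..n} \<and> x u = j" if "standardization n x u \<in> pile b j" for u
    proof -
      have "u \<in> {1..n}"
      proof (rule ccontr)
        assume "u \<notin> {1..n}"
        moreover from this have "standardization n x u = u" by (simp only: standardization_def if_False)
        ultimately show False using that pile_subset[OF b j] by auto
      qed
      then show ?thesis using pile_unique[OF that standardization_in_pile[OF x]] by simp
    qed
    show "standardization n x s < standardization n x t"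
      using in_range[of s] in_range[of t] st by (intro standardization_mono) auto
  qed
  ultimately show ?thesis by (simp add: interleavings_def)
qed

lemma pile_word_bij:
  assumes b: "b \<in> cuts n a"
  shows "bij_betw (pile_word n a b) (interleavings n a b) (words_with_counts n a b)"
proof (rule bij_betw_byWitness[where f' = "standardization n"])
  show "\<forall>\<rho>\<in>interleavings n a b. standardization n (pile_word n a b \<rho>) = \<rho>"
    using standardization_pile_word[OF b] by blast
  show "\<forall>x\<in>words_with_counts n a b. pile_word n a b (standardization n x) = x"
  proof (intro ballI ext)
    fix x s assume x: "x \<in> words_with_counts n a b"
    then have w: "x \<in> words n a" by (simp add: words_with_counts_def)
    show "pile_word n a b (standardization n x) s = x s"
    proof (cases "s \<in> {1..n}")
      case True
      then show ?thesis
        by (intro pile_word_eqI word_letter[OF w] standardization_in_pile[OF x] True)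
    next
      case False
      then show ?thesis using w by (auto simp: pile_word_def words_def PiE_def extensional_def)
    qed
  qed
  show "pile_word n a b ` interleavings n a b \<subseteq> words_with_counts n a b"
    using pile_word_in_words_with_counts[OF b] by blast
  show "standardization n ` words_with_counts n a b \<subseteq> interleavings n a b"
    using standardization_in_interleavings[OF b] by blast
qed

lemma inversions_interleaving_pmf:
  assumes b: "b \<in> cuts n a"
  shows "map_pmf (inversions n) (pmf_of_set (interleavings n a b))
       = map_pmf (inversions n) (pmf_of_set (words_with_counts n a b))"
proof -
  have "pmf_of_set (words_with_counts n a b) = map_pmf (pile_word n a b) (pmf_of_set (interleavings n a b))"
    using map_pmf_of_set_bij_betw[OF pile_word_bij[OF b] interleavings_nonempty finite_interleavings] by simp
  then have "map_pmf (inversions n) (pmf_of_set (words_with_counts n a b))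
      = map_pmf (\<lambda>\<rho>. inversions n (pile_word n a b \<rho>)) (pmf_of_set (interleavings n a b))"
    by (simp add: pmf.map_comp o_def)
  also have "\<dots> = map_pmf (inversions n) (pmf_of_set (interleavings n a b))"
    using inversions_pile_word[OF b]
    by (intro map_pmf_cong) (auto simp: set_pmf_of_set interleavings_nonempty finite_interleavings)
  finally show ?thesis by simp
qed

text \<open>
  Written as lists, these words are the arrangements of the multiset in which \<open>j\<close> occurs \<open>b j\<close>
  times.
\<close>

lemma card_words_with_counts:
  assumes b: "b \<in> cuts n a"
  shows "real (card (words_with_counts n a b)) = multinomial n a b"
proof -
  define A where "A = (\<Sum>j=1..a. replicate_mset (b j) j)"
  have count: "count A j = b j" for j
  proof -
    have "count A j = (\<Sum>i=1..a. if i = j then b i else 0)"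
      unfolding A_def count_sum by (intro sum.cong) auto
    also have "\<dots> = b j" using b by (auto simp: cuts_def)
    finally show ?thesis .
  qed
  have setA: "set_mset A \<subseteq> {1..a}"
    using b by (auto simp: count cuts_def count_greater_zero_iff[symmetric] intro: ccontr)
  have size: "size A = n"
  proof -
    have "size A = (\<Sum>j\<in>set_mset A. b j)" by (simp add: size_multiset_overloaded_eq count)
    also have "\<dots> = (\<Sum>j=1..a. b j)"
      by (rule sum.mono_neutral_left[OF _ setA]) (auto simp: not_in_iff count)
    finally show ?thesis using b by (simp add: cuts_def)
  qed
  have letters: "count (mset (map x [1..<Suc n])) j = card {s \<in> {1..n}. x s = j}" for x :: "nat \<Rightarrow> nat" and j
  proof -
    have "{1..<Suc n} = {1..n}" by auto
    then show ?thesis by (simp only: mset_map mset_upt count_image_mset_eq_card_vimage finite_atLeastAtMost)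
  qed
  have "bij_betw (\<lambda>x. map x [1..<Suc n]) (words_with_counts n a b) (permutations_of_multiset A)"
  proof (rule bij_betw_byWitness[where f' = "\<lambda>xs. \<lambda>s\<in>{1..n}. xs ! (s - 1)"])
    have inv: "(\<lambda>s\<in>{1..n}. map x [1..<Suc n] ! (s - 1)) = x" if "x \<in> words n a" for x
      using that by (auto simp: words_def PiE_def extensional_def fun_eq_iff nth_append simp del: upt_Suc)
    then show "\<forall>x\<in>words_with_counts n a b. (\<lambda>s\<in>{1..n}. map x [1..<Suc n] ! (s - 1)) = x"
      by (auto simp: words_with_counts_def)
    have len: "length xs = n" if "mset xs = A" for xs using that size by (metis size_mset)
    have inv': "map (\<lambda>s\<in>{1..n}. xs ! (s - 1)) [1..<Suc n] = xs" if "mset xs = A" for xs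
      by (rule nth_equalityI) (auto simp: len[OF that] simp del: upt_Suc)
    then show "\<forall>xs\<in>permutations_of_multiset A. map (\<lambda>s\<in>{1..n}. xs ! (s - 1)) [1..<Suc n] = xs"
      by (auto simp: permutations_of_multiset_def)
    show "(\<lambda>x. map x [1..<Suc n]) ` words_with_counts n a b \<subseteq> permutations_of_multiset A"
    proof (rule image_subsetI, rule permutations_of_multisetI)
      fix x assume x: "x \<in> words_with_counts n a b"
      show "mset (map x [1..<Suc n]) = A"
      proof (rule multiset_eqI)
        fix j show "count (mset (map x [1..<Suc n])) j = count A j"
        proof (cases "j \<in> {1..a}")
          case True
          then show ?thesis using x unfolding letters count by (simp add: words_with_counts_def)
        next
          case False
          then have "{s \<in> {1..n}. x s = j} = {}" using x word_letter by (auto simp: words_with_counts_def)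
          moreover have "b j = 0" using False b by (simp add: cuts_def)
          ultimately show ?thesis unfolding letters count by simp
        qed
      qed
    qed
    show "(\<lambda>xs. \<lambda>s\<in>{1..n}. xs ! (s - 1)) ` permutations_of_multiset A \<subseteq> words_with_counts n a b"
    proof (rule image_subsetI)
      fix xs assume "xs \<in> permutations_of_multiset A"
      then have xs: "mset xs = A" by (simp add: permutations_of_multiset_def)
      let ?x = "\<lambda>s\<in>{1..n}. xs ! (s - 1)"
      have "card {s \<in> {1..n}. ?x s = j} = b j" for j
        unfolding letters[symmetric] inv'[OF xs] xs count ..
      moreover have "xs ! (s - 1) \<in> {1..a}" if "s \<in> {1..n}" for s
      proof -
        have "xs ! (s - 1) \<in> set xs" using that len[OF xs] by (intro nth_mem) auto
        then show ?thesis using setA xs by (metis set_mset_mset subsetD)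
      qed
      then have "?x \<in> words n a" by (auto simp: words_def)
      ultimately show "?x \<in> words_with_counts n a b" by (simp add: words_with_counts_def)
    qed
  qed
  then have "card (words_with_counts n a b) = card (permutations_of_multiset A)"
    by (rule bij_betw_same_card)
  moreover have "card (permutations_of_multiset A) * (\<Prod>j=1..a. fact (b j)) = fact n"
  proof -
    have "(\<Prod>j\<in>set_mset A. fact (count A j) :: nat) = (\<Prod>j=1..a. fact (count A j))"
      using setA by (intro prod.mono_neutral_left) (auto simp: not_in_iff)
    then show ?thesis using card_permutations_of_multiset_aux[of A] by (simp add: size count)
  qed
  then have "real (card (permutations_of_multiset A)) * (\<Prod>j=1..a. fact (b j)) = fact n"
    by (metis (mono_tags, lifting) of_nat_fact of_nat_mult of_nat_prod prod.cong)
  ultimately show ?thesis by (simp add: multinomial_def field_simps)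
qed

text \<open>
  The probability of a cut is the number of words with these letter counts, divided by \<open>a ^ n\<close>; a
  uniform choice among these words cancels the first factor.
\<close>

lemma uniform_word_pmf:
  assumes a: "a > 0"
  shows "bind_pmf (cut_pmf n a (\<lambda>_. 1 / real a)) (\<lambda>b. pmf_of_set (words_with_counts n a b))
    = pmf_of_set (words n a)"
proof (rule pmf_eqI)
  fix x
  let ?p = "\<lambda>_ :: nat. 1 / real a" and ?ww = "words_with_counts n a"
  have pmf_cut: "pmf (cut_pmf n a ?p) b = cut_prob n a ?p b" for b
    by (rule pmf_cut_pmf) (use a in auto)
  have fin: "finite (?ww b)" for b
    by (rule finite_subset[OF _ finite_words[of n a]]) (auto simp: words_with_counts_def)
  have multinomial_pos: "multinomial n a b > 0" for b
    unfolding multinomial_def by (intro divide_pos_pos prod_pos) auto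
  have ne: "?ww b \<noteq> {}" if "b \<in> cuts n a" for b
    using card_words_with_counts[OF that] multinomial_pos[of b] by auto
  have "pmf (bind_pmf (cut_pmf n a ?p) (\<lambda>b. pmf_of_set (?ww b))) x
     = (\<Sum>b\<in>cuts n a. cut_prob n a ?p b * pmf (pmf_of_set (?ww b)) x)"
    unfolding pmf_bind
    by (subst integral_measure_pmf[OF finite_cuts[of n a]])
       (auto simp: pmf_cut set_pmf_iff cut_prob_def split: if_splits)
  also have "\<dots> = (\<Sum>b\<in>cuts n a. indicator (?ww b) x * (1 / real a) ^ n)"
  proof (rule sum.cong)
    fix b assume b: "b \<in> cuts n a"
    have "(\<Prod>i=1..a. (1 / real a) ^ b i) = (1 / real a) ^ n"
      using b by (simp add: power_sum[symmetric] cuts_def)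
    then show "cut_prob n a ?p b * pmf (pmf_of_set (?ww b)) x = indicator (?ww b) x * (1 / real a) ^ n"
      using b multinomial_pos[of b]
      by (simp add: cut_prob_def pmf_of_set[OF ne[OF b] fin] card_words_with_counts)
  qed simp
  also have "\<dots> = indicator (words n a) x * (1 / real a) ^ n"
  proof (cases "x \<in> words n a")
    case True
    define b where "b = (\<lambda>j. if j \<in> {1..a} then card {s \<in> {1..n}. x s = j} else 0)"
    have "(\<Sum>j=1..a. b j) = card (\<Union>j\<in>{1..a}. {s \<in> {1..n}. x s = j})"
      by (subst card_UN_disjoint) (auto simp: b_def)
    also have "(\<Union>j\<in>{1..a}. {s \<in> {1..n}. x s = j}) = {1..n}"
      using word_letter[OF True] by auto
    finally have b: "b \<in> cuts n a" by (auto simp: cuts_def b_def)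
    have "indicator (?ww b') x = (if b' = b then 1 else 0 :: real)" if "b' \<in> cuts n a" for b'
    proof -
      have "x \<in> ?ww b' \<longleftrightarrow> b' = b"
      proof
        assume x: "x \<in> ?ww b'"
        show "b' = b"
        proof
          fix j
          show "b' j = b j"
          proof (cases "j \<in> {1..a}")
            case True
            then show ?thesis using x by (simp add: words_with_counts_def b_def)
          next
            case False
            then have "b' j = 0" using that unfolding cuts_def by blast
            then show ?thesis using False by (simp only: b_def if_False)
          qed
        qed
      qed (use True in \<open>simp add: words_with_counts_def b_def\<close>)
      then show ?thesis by (simp add: indicator_def)
    qed
    then have "(\<Sum>b\<in>cuts n a. indicator (?ww b) x * (1 / real a) ^ n)
        = (\<Sum>b'\<in>cuts n a. if b' = b then (1 / real a) ^ n else 0)"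
      by (intro sum.cong) auto
    then show ?thesis using b True by (simp add: finite_cuts)
  next
    case False
    then show ?thesis by (auto simp: words_with_counts_def intro!: sum.neutral)
  qed
  also have "\<dots> = pmf (pmf_of_set (words n a)) x"
    by (simp add: pmf_of_set[OF words_nonempty[OF a] finite_words])
       (simp add: words_def card_PiE power_divide)
  finally show "pmf (bind_pmf (cut_pmf n a ?p) (\<lambda>b. pmf_of_set (?ww b))) x = pmf (pmf_of_set (words n a)) x" .
qed

lemma inversions_riffle_pmf:
  assumes a: "a > 0"
  shows "map_pmf (inversions n) (unbiased_riffle_pmf n a) = map_pmf (inversions n) (pmf_of_set (words n a))"
proof -
  let ?p = "\<lambda>_ :: nat. 1 / real a"
  have "map_pmf (inversions n) (unbiased_riffle_pmf n a)
     = bind_pmf (cut_pmf n a ?p) (\<lambda>b. map_pmf (inversions n) (pmf_of_set (interleavings n a b)))"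
    by (simp add: unbiased_riffle_pmf_def riffle_pmf_def map_bind_pmf)
  also have "\<dots> = bind_pmf (cut_pmf n a ?p) (\<lambda>b. map_pmf (inversions n) (pmf_of_set (words_with_counts n a b)))"
  proof (rule bind_pmf_cong)
    fix b assume "b \<in> set_pmf (cut_pmf n a ?p)"
    then have "cut_prob n a ?p b \<noteq> 0"
      using a by (subst pmf_cut_pmf[symmetric]) (auto simp: set_pmf_iff)
    then have "b \<in> cuts n a" by (auto simp: cut_prob_def split: if_splits)
    then show "map_pmf (inversions n) (pmf_of_set (interleavings n a b))
        = map_pmf (inversions n) (pmf_of_set (words_with_counts n a b))"
      by (rule inversions_interleaving_pmf)
  qed simp
  also have "\<dots> = map_pmf (inversions n) (pmf_of_set (words n a))"
    by (simp add: map_bind_pmf[symmetric] uniform_word_pmf[OF a])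
  finally show ?thesis .
qed

section \<open>The Berry-Esseen bound\<close>

lemma cdf_riffle_inversions:
  fixes g :: "nat \<Rightarrow> real"
  assumes a: "a > 0"
  shows "cdf (distr (measure_pmf (unbiased_riffle_pmf n a)) borel (\<lambda>\<rho>. g (inversions n \<rho>))) z
    = mean (words n a) (\<lambda>x. of_bool (g (inversions n x) \<le> z))"
proof -
  have "cdf (distr (measure_pmf (unbiased_riffle_pmf n a)) borel (\<lambda>\<rho>. g (inversions n \<rho>))) z
      = measure_pmf.prob (unbiased_riffle_pmf n a) (inversions n -` {k. g k \<le> z})"
    by (simp add: cdf_def measure_distr vimage_def)
  also have "\<dots> = measure_pmf.prob (pmf_of_set (words n a)) (inversions n -` {k. g k \<le> z})"
    by (simp only: measure_map_pmf[symmetric] inversions_riffle_pmf[OF a])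
  also have "\<dots> = mean (words n a) (\<lambda>x. of_bool (g (inversions n x) \<le> z))"
    unfolding mean_def sum_of_bool_eq[OF finite_words finite_words]
    by (simp add: measure_pmf_of_set[OF words_nonempty[OF a] finite_words] vimage_def)
  finally show ?thesis .
qed

theorem theorem3p2:
  fixes a :: nat
  assumes "a \<ge> 2"
  shows "\<exists>C::real. \<forall>n::nat. n \<ge> 2 \<longrightarrow>
    kolmogorov_dist
      (distr (measure_pmf (unbiased_riffle_pmf n a)) borel
        (\<lambda>\<rho>. (real (inversions n \<rho>) - real n * (real n - 1) / 4 * ((real a - 1) / real a))
              / (sqrt (real n) * (real n - 1) * sqrt (((real a)\<^sup>2 - 1) / (36 * (real a)\<^sup>2)))))
      std_normal_distribution
    \<le> C / sqrt (real n)"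
proof -
  obtain c where c: "\<And>z w. stein_sol z w \<le> c" using stein_sol_bounded by blast
  let ?C = "132 / riffle_variance a + 4 * c / sqrt (riffle_variance a)"
  show ?thesis
  proof (intro exI[of _ ?C] allI impI)
    fix n :: nat assume n: "n \<ge> 2"
    let ?m = "real n * (real n - 1) / 4 * ((real a - 1) / real a)"
    let ?s = "sqrt (real n) * (real n - 1) * sqrt (((real a)\<^sup>2 - 1) / (36 * (real a)\<^sup>2))"
    have a0: "a > 0" using assms by simp
    have "\<bar>cdf (distr (measure_pmf (unbiased_riffle_pmf n a)) borel
        (\<lambda>\<rho>. (real (inversions n \<rho>) - ?m) / ?s)) z - \<Phi> z\<bar> \<le> ?C / sqrt (real n)" for z
      unfolding cdf_riffle_inversions[OF a0, where g = "\<lambda>k. (real k - ?m) / ?s"]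
      using word_inversions_normal_bound[OF assms n c, of z] by (simp only: riffle_variance_def)
    then show "kolmogorov_dist (distr (measure_pmf (unbiased_riffle_pmf n a)) borel
        (\<lambda>\<rho>. (real (inversions n \<rho>) - ?m) / ?s)) std_normal_distribution \<le> ?C / sqrt (real n)"
      unfolding kolmogorov_dist_def by (intro cSUP_least) auto
  qed
qed

end
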